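(* Let $n\ge 2$, $0<\theta\le\pi$, $0\le\phi\le\pi/2$. Suppose that the real function $f$ on $[-1,1]$ is a nonnegative linear combination of Gegenbauer polynomials $G_k^{(n)}(t)$, i.e. $$f(t)=\sum_k f_k G_k^{(n)}(t),\qquad f_k\ge 0 .$$ If $f(t)\le 0$ for all $t\in[-\cos\phi,\cos\theta]$ and $f_0>0$, then $$A(n,\theta)\le \frac{h_{\max}(n,\theta,\phi,f)}{f_0}.$$
   Context: $S^{n-1}$ is the unit sphere in $\mathbb R^n$, $e_n=(0,\dots,0,1)$, $\operatorname{dist}$ is angular distance on the sphere, and $\mathrm{Cap}(n,\phi)=\{x\in S^{n-1}:\langle x,e_n\rangle\ge\cos\phi\}$. A finite set $C\subset S^{n-1}$ is a $\theta$-code if $\operatorname{dist}(x,y)\ge\theta$ for all distinct $x,y\in C$. $A(n,\theta)$ is the maximum size of a $\theta$-code in $S^{n-1}$, and $A(n,\theta,\phi)$ is the maximum size of a $\theta$-code contained in $\mathrm{Cap}(n,\phi)$. $\{G_k^{(n)}\}_{k=0,1,\dots}$ are the Gegenbauer polynomials: $G_k^{(n)}$ has degree $k$, the family is orthogonal on $[-1,1]$ with weight $(1-x^2)^{(n-3)/2}$, and $G_k^{(n)}(1)=1$. Let $e_n^*=-e_n$. For a $\theta$-code $Y=\{y_1,\dots,y_m\}$ of size $m$ in $\mathrm{Cap}(n,\phi)$ (with $m=0$ allowed) put $$H_f(Y)=f(1)+f(\langle e_n^*,y_1\rangle)+\dots+f(\langle e_n^*,y_m\rangle).$$ Let $h_m(n,\theta,\phi,f)$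 be the maximum of $H_f(Y)$ over all $\theta$-codes $Y\subset \mathrm{Cap}(n,\phi)$ of size $m$ (so $h_0=f(1)$), and let $h_{\max}(n,\theta,\phi,f)=\max_{0\le m\le A(n,\theta,\phi)} h_m(n,\theta,\phi,f)$. *)

theory Defs
  imports "HOL-Analysis.Analysis" "HOL-Computational_Algebra.Polynomial"
begin

definition north_pole :: "real ^ 'n::{finite,linorder}" where
  "north_pole = axis (Max UNIV) 1"

definition angular_dist :: "real ^ 'n \<Rightarrow> real ^ 'n \<Rightarrow> real" where
  "angular_dist x y = arccos (x \<bullet> y)"

definition Cap :: "real \<Rightarrow> (real ^ 'n::{finite,linorder}) set" where
  "Cap \<phi> = {x \<in> sphere 0 1. x \<bullet> north_pole \<ge> cos \<phi>}"

definition is_code :: "real \<Rightarrow> (real ^ 'n) set \<Rightarrow> bool" where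
  "is_code \<theta> C \<longleftrightarrow> finite C \<and> C \<subseteq> sphere 0 1 \<and>
     (\<forall>x\<in>C. \<forall>y\<in>C. x \<noteq> y \<longrightarrow> angular_dist x y \<ge> \<theta>)"

text \<open>In the following constants the dimension is \<open>n = CARD('n)\<close>, passed as a type argument.
  For \<open>0 < \<theta> \<le> \<pi>\<close> the sets of cardinalities are finite and contain 0;
  see \<open>finite_code_sizes\<close> below.\<close>

definition max_code :: "'n::finite itself \<Rightarrow> real \<Rightarrow> nat" where
  "max_code _ \<theta> = Max {card C | C :: (real ^ 'n) set. is_code \<theta> C}"

definition max_cap_code :: "'n::{finite,linorder} itself \<Rightarrow> real \<Rightarrow> real \<Rightarrow> nat" where
  "max_cap_code _ \<theta> \<phi> = Max {card C | C :: (real ^ 'n::{finite,linorder}) set. is_code \<theta> C \<and> C \<subseteq> Cap \<phi>}"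

text \<open>\<open>G k\<close> is \<open>G\<^sub>k\<^sup>(\<^sup>n\<^sup>)\<close>. The three conditions determine the family uniquely.
  The integrand is set to 0 at the endpoints \<open>x = 1\<close> and \<open>x = -1\<close> by the
  convention \<open>0 powr a = 0\<close>, which does not affect the integral.\<close>

definition is_gegenbauer_family :: "nat \<Rightarrow> (nat \<Rightarrow> real poly) \<Rightarrow> bool" where
  "is_gegenbauer_family n G \<longleftrightarrow>
     (\<forall>k. degree (G k) = k) \<and>
     (\<forall>j k. j \<noteq> k \<longrightarrow>
        ((\<lambda>x. poly (G j) x * poly (G k) x * (1 - x\<^sup>2) powr ((real n - 3) / 2)) has_integral 0) {-1..1}) \<and>
     (\<forall>k. poly (G k) 1 = 1)"

definition H_sum :: "(real \<Rightarrow> real) \<Rightarrow> (real ^ 'n::{finite,linorder}) set \<Rightarrow> real" where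
  "H_sum f Y = f 1 + (\<Sum>y\<in>Y. f ((- north_pole) \<bullet> y))"

text \<open>The supremum is a maximum for continuous \<open>f\<close>; see \<open>h_opt_attained\<close> below.\<close>

definition h_opt :: "'n::{finite,linorder} itself \<Rightarrow> real \<Rightarrow> real \<Rightarrow> (real \<Rightarrow> real) \<Rightarrow> nat \<Rightarrow> real" where
  "h_opt _ \<theta> \<phi> f m =
     Sup {H_sum f Y | Y :: (real ^ 'n::{finite,linorder}) set. is_code \<theta> Y \<and> Y \<subseteq> Cap \<phi> \<and> card Y = m}"

definition h_max :: "'n::{finite,linorder} itself \<Rightarrow> real \<Rightarrow> real \<Rightarrow> (real \<Rightarrow> real) \<Rightarrow> real" where
  "h_max n \<theta> \<phi> f = Max (h_opt n \<theta> \<phi> f ` {0..max_cap_code n \<theta> \<phi>})"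


lemma angular_dist_ge_iff:
  fixes x y :: "real ^ 'n"
  assumes "x \<in> sphere 0 1" "y \<in> sphere 0 1" "0 < \<theta>" "\<theta> \<le> pi"
  shows "angular_dist x y \<ge> \<theta> \<longleftrightarrow> x \<bullet> y \<le> cos \<theta>"
proof -
  have b: "\<bar>x \<bullet> y\<bar> \<le> 1"
    using Cauchy_Schwarz_ineq2[of x y] assms by simp
  then have "arccos (x \<bullet> y) \<ge> \<theta> \<longleftrightarrow> cos (arccos (x \<bullet> y)) \<le> cos \<theta>"
    using assms arccos_lbound[of "x \<bullet> y"] arccos_ubound[of "x \<bullet> y"]
    by (subst cos_mono_le_eq) auto
  then show ?thesis using b by (simp add: angular_dist_def cos_arccos_abs)
qed

lemma cos_less_one: "0 < \<theta> \<Longrightarrow> \<theta> \<le> pi \<Longrightarrow> cos \<theta> < 1"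
  using cos_monotone_0_pi[of 0 \<theta>] by simp

lemma code_card_bounded:
  fixes \<theta> :: real
  assumes "0 < \<theta>" "\<theta> \<le> pi"
  obtains B where "\<And>C :: (real ^ 'n) set. is_code \<theta> C \<Longrightarrow> card C \<le> B"
proof -
  define d where "d = sqrt (2 - 2 * cos \<theta>)"
  have d: "d > 0" using cos_less_one[OF assms] by (simp add: d_def)
  obtain T where T: "finite T" "sphere (0 :: real ^ 'n) 1 \<subseteq> (\<Union>t\<in>T. ball t (d / 2))"
  proof -
    have "sphere (0 :: real ^ 'n) 1 \<subseteq> (\<Union>t\<in>sphere 0 1. ball t (d / 2))"
      using d by force
    then show ?thesis
      by (metis that compactE_image compact_sphere open_ball)
  qed
  have "card C \<le> card T" if C: "is_code \<theta> C" for C :: "(real ^ 'n) set"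
  proof -
    have "\<forall>x\<in>C. \<exists>t\<in>T. dist t x < d / 2"
      using C T(2) by (force simp: is_code_def)
    then obtain g where g: "\<And>x. x \<in> C \<Longrightarrow> g x \<in> T \<and> dist (g x) x < d / 2"
      by metis
    have "inj_on g C"
    proof (rule inj_onI, rule ccontr)
      fix x y assume xy: "x \<in> C" "y \<in> C" "g x = g y" "x \<noteq> y"
      have s: "x \<in> sphere 0 1" "y \<in> sphere 0 1"
        using C xy by (auto simp: is_code_def)
      have "x \<bullet> y \<le> cos \<theta>"
        using C xy angular_dist_ge_iff[OF s assms] by (auto simp: is_code_def)
      moreover have "(norm (x - y))\<^sup>2 = 2 - 2 * (x \<bullet> y)"
        using s by (simp add: power2_norm_eq_inner inner_diff inner_commute norm_eq_1)
      ultimately have "d \<le> dist x y"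
        unfolding d_def dist_norm by (intro real_le_lsqrt) auto
      moreover have "dist x y < d"
        using g[OF xy(1)] g[OF xy(2)] xy(3) by (metis dist_triangle_half_r)
      ultimately show False by simp
    qed
    then show ?thesis using g T(1) by (intro card_inj_on_le[of g]) auto
  qed
  then show ?thesis using that by blast
qed

lemma finite_code_sizes:
  assumes "0 < \<theta>" "\<theta> \<le> pi"
  shows "finite {card C | C :: (real ^ 'n) set. is_code \<theta> C}"
    and "finite {card C | C :: (real ^ 'm::{finite,linorder}) set. is_code \<theta> C \<and> C \<subseteq> Cap \<phi>}"
proof -
  obtain B where "\<And>C :: (real ^ 'n) set. is_code \<theta> C \<Longrightarrow> card C \<le> B"
    using code_card_bounded[OF assms] by blast
  then show "finite {card C | C :: (real ^ 'n) set. is_code \<theta> C}"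
    by (intro finite_subset[OF _ finite_atMost[of B]]) auto
next
  obtain B where "\<And>C :: (real ^ 'm::{finite,linorder}) set. is_code \<theta> C \<Longrightarrow> card C \<le> B"
    using code_card_bounded[OF assms] by blast
  then show "finite {card C | C :: (real ^ 'm::{finite,linorder}) set. is_code \<theta> C \<and> C \<subseteq> Cap \<phi>}"
    by (intro finite_subset[OF _ finite_atMost[of B]]) auto
qed

lemma h_opt_attained:
  fixes f :: "real \<Rightarrow> real"
  assumes \<theta>: "0 < \<theta>" "\<theta> \<le> pi" and f: "continuous_on {-1..1} f"
    and m: "m \<le> max_cap_code TYPE('n::{finite,linorder}) \<theta> \<phi>"
  obtains Y :: "(real ^ 'n::{finite,linorder}) set"
    where "is_code \<theta> Y" "Y \<subseteq> Cap \<phi>" "card Y = m" "h_opt TYPE('n::{finite,linorder}) \<theta> \<phi> f m = H_sum f Y"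
      "\<And>Z :: (real ^ 'n::{finite,linorder}) set. is_code \<theta> Z \<Longrightarrow> Z \<subseteq> Cap \<phi> \<Longrightarrow> card Z = m \<Longrightarrow> H_sum f Z \<le> H_sum f Y"
proof -
  let ?P = "\<lambda>Y :: (real, 'n) vec set. is_code \<theta> Y \<and> Y \<subseteq> Cap \<phi> \<and> card Y = m"
  define T :: "(nat \<Rightarrow> (real, 'n) vec) set" where
    "T = (Pi UNIV (\<lambda>_. Cap \<phi>)) \<inter> {y. \<forall>i<m. \<forall>j<m. i \<noteq> j \<longrightarrow> y i \<bullet> y j \<le> cos \<theta>}"
  define F where "F y = f 1 + (\<Sum>i<m. f ((- north_pole) \<bullet> y i))" for y :: "nat \<Rightarrow> (real, 'n) vec"
  have proj: "continuous_on A (\<lambda>y :: nat \<Rightarrow> (real, 'n) vec. y i)" for A i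
    by (rule continuous_on_subset[OF continuous_on_product_coordinates]) simp
  have np: "norm (north_pole :: (real, 'n) vec) = 1"
    by (simp add: north_pole_def norm_eq_1 inner_axis_axis)
  have "compact (Cap \<phi> :: (real, 'n) vec set)"
  proof -
    have "(Cap \<phi> :: (real, 'n) vec set) = sphere 0 1 \<inter> {x. north_pole \<bullet> x \<ge> cos \<phi>}"
      by (auto simp: Cap_def inner_commute)
    then show ?thesis
      by (simp add: compact_Int_closed closed_halfspace_ge)
  qed
  then have "compact (Pi UNIV (\<lambda>_. Cap \<phi>) :: (nat \<Rightarrow> (real, 'n) vec) set)"
    using compactin_PiE[of "\<lambda>_::nat. euclidean" UNIV "\<lambda>_. Cap \<phi> :: (real, 'n) vec set"]
    by (simp add: euclidean_product_topology PiE_UNIV_domain)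
  moreover have "closed {y :: nat \<Rightarrow> (real, 'n) vec. \<forall>i<m. \<forall>j<m. i \<noteq> j \<longrightarrow> y i \<bullet> y j \<le> cos \<theta>}"
  proof -
    have "{y :: nat \<Rightarrow> (real, 'n) vec. \<forall>i<m. \<forall>j<m. i \<noteq> j \<longrightarrow> y i \<bullet> y j \<le> cos \<theta>} =
        (\<Inter>i\<in>{..<m}. \<Inter>j\<in>{..<m} - {i}. {y. y i \<bullet> y j \<le> cos \<theta>})"
      by auto
    moreover have "closed {y :: nat \<Rightarrow> (real, 'n) vec. y i \<bullet> y j \<le> cos \<theta>}" for i j
      by (intro closed_Collect_le continuous_on_inner proj continuous_on_const)
    ultimately show ?thesis by (auto intro!: closed_INT)
  qed
  ultimately have cT: "compact T"
    unfolding T_def by (rule compact_Int_closed)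
  have cF: "continuous_on T F"
    unfolding F_def
  proof (intro continuous_intros continuous_on_compose2[OF f] proj subsetI)
    fix i z assume "z \<in> (\<lambda>y. (- north_pole) \<bullet> y i) ` T"
    then obtain y where y: "y \<in> T" "z = (- north_pole) \<bullet> y i" by auto
    then have "norm (y i) = 1" by (auto simp: T_def Cap_def)
    then have "\<bar>z\<bar> \<le> 1"
      using y(2) np Cauchy_Schwarz_ineq2[of "- north_pole" "y i"] by simp
    then show "z \<in> {-1..1}" by auto
  qed
  have toset: "?P (y ` {..<m}) \<and> H_sum f (y ` {..<m}) = F y" if y: "y \<in> T" for y
  proof -
    have s: "y i \<in> sphere 0 1" "y i \<in> Cap \<phi>" for i
      using y by (auto simp: T_def Cap_def)
    have le: "y i \<bullet> y j \<le> cos \<theta>" if "i < m" "j < m" "i \<noteq> j" for i j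
      using y that by (auto simp: T_def)
    have inj: "inj_on y {..<m}"
    proof (rule inj_onI, rule ccontr)
      fix i j assume ij: "i \<in> {..<m}" "j \<in> {..<m}" "y i = y j" "i \<noteq> j"
      then have "y i \<bullet> y i \<le> cos \<theta>" using le[of i j] by simp
      moreover have "y i \<bullet> y i = 1" using s(1)[of i] by (simp add: norm_eq_1)
      ultimately show False using cos_less_one[OF \<theta>] by simp
    qed
    have "is_code \<theta> (y ` {..<m})"
      using s(1) angular_dist_ge_iff[OF s(1) s(1) \<theta>]
      by (auto simp: is_code_def intro!: le)
    then show ?thesis
      using inj s(2) by (auto simp: card_image H_sum_def F_def sum.reindex)
  qed
  have fromset: "\<exists>y\<in>T. F y = H_sum f Y" if Y: "?P Y" "T \<noteq> {} \<or> m > 0" for Y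
  proof -
    obtain c where c: "c \<in> (Cap \<phi> :: (real, 'n) vec set)"
    proof (cases "m = 0")
      case True
      then show ?thesis using Y(2) that by (auto simp: T_def)
    next
      case False
      then have "Y \<noteq> {}" using Y(1) by auto
      then show ?thesis using Y(1) that by auto
    qed
    obtain g where g: "bij_betw g {..<m} Y"
      using Y(1) ex_bij_betw_nat_finite[of Y] by (auto simp: is_code_def atLeast0LessThan)
    define y where "y i = (if i < m then g i else c)" for i
    have yY: "y i \<in> Y" if "i < m" for i
      using g that by (auto simp: y_def bij_betw_def)
    have "y i \<bullet> y j \<le> cos \<theta>" if ij: "i < m" "j < m" "i \<noteq> j" for i j
    proof -
      have "y i \<noteq> y j" using g ij by (auto simp: y_def bij_betw_def inj_on_def)
      then have "angular_dist (y i) (y j) \<ge> \<theta>"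
        using Y(1) yY ij by (auto simp: is_code_def)
      moreover have "y i \<in> sphere 0 1" "y j \<in> sphere 0 1"
        using Y(1) yY[OF ij(1)] yY[OF ij(2)] by (auto simp: is_code_def)
      ultimately show ?thesis
        using angular_dist_ge_iff[OF _ _ \<theta>] by blast
    qed
    moreover have "y i \<in> Cap \<phi>" for i
      using yY[of i] Y(1) c by (cases "i < m") (auto simp: y_def)
    ultimately have "y \<in> T" by (auto simp: T_def)
    moreover have "F y = H_sum f Y"
      unfolding F_def H_sum_def
      using sum.reindex_bij_betw[OF g, of "\<lambda>v. f ((- north_pole) \<bullet> v)"] by (simp add: y_def)
    ultimately show ?thesis by blast
  qed
  obtain Y where Y: "?P Y" "\<And>Z. ?P Z \<Longrightarrow> H_sum f Z \<le> H_sum f Y"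
  proof (cases "m = 0")
    case True
    show ?thesis
    proof (rule that)
      show "?P {}" using True by (simp add: is_code_def)
      show "H_sum f Z \<le> H_sum f ({} :: (real, 'n) vec set)" if "?P Z" for Z
      proof -
        have "Z = {}" using that True by (auto simp: is_code_def)
        then show ?thesis by simp
      qed
    qed
  next
    case False
    have "max_cap_code TYPE('n) \<theta> \<phi> \<in> {card C | C :: (real, 'n) vec set. is_code \<theta> C \<and> C \<subseteq> Cap \<phi>}"
      unfolding max_cap_code_def
    proof (rule Max_in)
      show "finite {card C | C :: (real, 'n) vec set. is_code \<theta> C \<and> C \<subseteq> Cap \<phi>}"
        by (rule finite_code_sizes(2)[OF \<theta>])
      have "is_code \<theta> ({} :: (real, 'n) vec set)" by (simp add: is_code_def)
      then show "{card C | C :: (real, 'n) vec set. is_code \<theta> C \<and> C \<subseteq> Cap \<phi>} \<noteq> {}" by blast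
    qed
    then obtain C :: "(real, 'n) vec set" where C: "is_code \<theta> C" "C \<subseteq> Cap \<phi>" "m \<le> card C"
      using m by auto
    obtain D where D: "D \<subseteq> C" "card D = m"
      using obtain_subset_with_card_n[OF C(3)] by blast
    have "is_code \<theta> D"
      using C(1) D(1) unfolding is_code_def by (meson finite_subset subset_trans subsetD)
    then have "?P D"
      using C(2) D by blast
    then have "T \<noteq> {}" using fromset False by blast
    then obtain y where y: "y \<in> T" "\<And>z. z \<in> T \<Longrightarrow> F z \<le> F y"
      using continuous_attains_sup[OF cT _ cF] by blast
    show ?thesis
    proof (rule that)
      show "?P (y ` {..<m})" using toset[OF y(1)] by blast
      show "H_sum f Z \<le> H_sum f (y ` {..<m})" if Z: "?P Z" for Z
      proof -
        obtain z where "z \<in> T" "F z = H_sum f Z" using fromset[OF Z] False by blast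
        then show ?thesis using y(2)[of z] toset[OF y(1)] by simp
      qed
    qed
  qed
  have "h_opt TYPE('n) \<theta> \<phi> f m = H_sum f Y"
    unfolding h_opt_def by (rule cSup_eq_maximum) (use Y in auto)
  then show ?thesis using that[of Y] Y by blast
qed

end

theory Submission
  imports Defs
begin

text \<open>
  The proof is the Delsarte linear programming method with one twist, due to Musin, in the
  pointwise estimate. For a \<open>\<theta>\<close>-code \<open>C\<close> consider the double sum
  \<open>\<Sum>x\<in>C. \<Sum>y\<in>C. f (x \<bullet> y)\<close>.

  From below, each Gegenbauer polynomial is a positive definite function on the sphere
  (Schoenberg; \<open>Gegenbauer_positive_definite\<close>). So every term of the expansion of \<open>f\<close>
  contributes a nonnegative amount, and the constant term alone gives \<open>c 0 * (card C)\<^sup>2\<close>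
  (\<open>sum_code_ge\<close>).

  From above, fix \<open>x\<close> in \<open>C\<close>. A point \<open>y \<noteq> x\<close> of \<open>C\<close> has \<open>x \<bullet> y \<le> cos \<theta>\<close>, so it can contribute a
  positive amount to the row of \<open>x\<close> only if \<open>x \<bullet> y < - cos \<phi>\<close>, that is, if it lies in the open
  cap of radius \<open>\<phi>\<close> around \<open>- x\<close>. A rotation taking \<open>- x\<close> to the north pole turns these points
  into a code in \<open>Cap \<phi>\<close>, and the row sum is bounded by \<open>h_max\<close> (\<open>sum_code_row_le\<close>).
  Comparing both bounds and dividing by \<open>card C\<close> gives the theorem.

  The bulk of the text is positive definiteness. It rests on a reproducing formula
  (\<open>Gegenbauer_reproducing\<close>): up to a positive factor, \<open>poly (G k) (a \<bullet> b)\<close> is the integral of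
  \<open>poly (G k) (a \<bullet> z) * poly (G k) (b \<bullet> z)\<close> over the sphere, which exhibits the kernel as a Gram
  matrix in an \<open>L\<^sup>2\<close> space. Spherical harmonics are avoided. By rotation invariance the integral is
  a function of \<open>a \<bullet> b\<close>, and parity shows that it is a polynomial \<open>Q\<close> in \<open>a \<bullet> b\<close> of degree at most
  \<open>k\<close> (\<open>zonal_convolution_poly\<close>). Fubini's theorem moves the orthogonality of \<open>G k\<close> to
  polynomials of lower degree from the integrand to \<open>Q\<close>, which forces \<open>Q\<close> to be a multiple of
  \<open>G k\<close>. Here orthogonality has two meanings, for the weight \<open>(1 - x\<^sup>2) powr ((n - 3) / 2)\<close> on the
  interval and for the rotation invariant measure on the sphere; they agree because both moment
  sequences satisfy the same two-step recurrence (\<open>integral_zonal_poly\<close>).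
\<close>

section \<open>Lebesgue measure is invariant under orthogonal maps\<close>

lemma nn_integral_lborel_translate:
  fixes g :: "'a::euclidean_space \<Rightarrow> ennreal"
  assumes [measurable]: "g \<in> borel_measurable borel"
  shows "(\<integral>\<^sup>+x. g (x + t) \<partial>lborel) = (\<integral>\<^sup>+x. g x \<partial>lborel)"
proof -
  have "(\<integral>\<^sup>+x. g x \<partial>lborel) = (\<integral>\<^sup>+x. g x \<partial>distr lborel borel ((+) t))"
    by (simp only: lborel_distr_plus)
  also have "\<dots> = (\<integral>\<^sup>+x. g (x + t) \<partial>lborel)"
    by (subst nn_integral_distr) (auto simp: add.commute)
  finally show ?thesis ..
qed

text \<open>
  Only translation invariance is used: integrate \<open>1\<^sub>B (T x + y) * g y\<close> over both variables, where
  \<open>B\<close> is the unit ball. Integrating over \<open>x\<close> first gives \<open>vol B\<close> times the integral of \<open>g\<close>, because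
  \<open>B\<close> is invariant under \<open>T\<close>; shifting \<open>y\<close> by \<open>T x\<close> first gives \<open>vol B\<close> times the integral of
  \<open>g (- T x)\<close>. The sign is harmless, since \<open>- T\<close> is orthogonal as well.
\<close>

lemma nn_integral_lborel_orthogonal_neg:
  fixes g :: "'a::euclidean_space \<Rightarrow> ennreal" and T :: "'a \<Rightarrow> 'a"
  assumes T: "orthogonal_transformation T" and [measurable]: "g \<in> borel_measurable borel"
  shows "(\<integral>\<^sup>+x. g (- T x) \<partial>lborel) = (\<integral>\<^sup>+x. g x \<partial>lborel)"
proof -
  let ?B = "cball (0::'a) 1"
  have [measurable]: "?B \<in> sets borel"
    by simp
  have lin: "linear T"
    using T by (rule orthogonal_transformation_linear)
  then have [measurable]: "T \<in> borel_measurable borel"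
    by (intro borel_measurable_continuous_onI linear_continuous_on) (simp add: linear_conv_bounded_linear)
  obtain S where S: "\<And>y. T (S y) = y"
    using linear_injective_imp_surjective[OF lin orthogonal_transformation_inj[OF T]]
    by (metis surj_def)
  have nT: "norm (T x) = norm x" for x
    using T by (simp add: orthogonal_transformation)
  define V where "V = emeasure lborel ?B"
  have V: "V \<noteq> 0" "V \<noteq> \<infinity>"
    using content_cball_pos[of 1 "0::'a"] emeasure_lborel_cball_finite[of "0::'a" 1]
    by (auto simp: V_def measure_def)
  have left: "(\<integral>\<^sup>+x. indicator ?B (T x + y) * g y \<partial>lborel) = V * g y" for y
  proof -
    have "(\<integral>\<^sup>+x. indicator ?B (T x + y) * g y \<partial>lborel)
        = (\<integral>\<^sup>+x. indicator ?B (T (x + S y)) \<partial>lborel) * g y"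
      by (simp add: linear_add[OF lin] S nn_integral_multc[symmetric])
    also have "(\<integral>\<^sup>+x. indicator ?B (T (x + S y)) \<partial>lborel) = (\<integral>\<^sup>+x. indicator ?B (T x) \<partial>lborel :: ennreal)"
      by (rule nn_integral_lborel_translate) measurable
    also have "(\<lambda>x. indicator ?B (T x)) = (indicator ?B :: 'a \<Rightarrow> ennreal)"
      by (auto simp: fun_eq_iff indicator_def nT)
    finally show ?thesis by (simp add: V_def)
  qed
  have right: "(\<integral>\<^sup>+x. g (y - T x) \<partial>lborel) = (\<integral>\<^sup>+x. g (- T x) \<partial>lborel)" for y
  proof -
    have "(\<integral>\<^sup>+x. g (y - T x) \<partial>lborel) = (\<integral>\<^sup>+x. g (- T (x + S (- y))) \<partial>lborel)"
      by (simp add: linear_add[OF lin] S)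
    also have "\<dots> = (\<integral>\<^sup>+x. g (- T x) \<partial>lborel)"
      by (rule nn_integral_lborel_translate) measurable
    finally show ?thesis .
  qed
  have "V * (\<integral>\<^sup>+y. g y \<partial>lborel) = (\<integral>\<^sup>+y. \<integral>\<^sup>+x. indicator ?B (T x + y) * g y \<partial>lborel \<partial>lborel)"
    by (simp add: left nn_integral_cmult)
  also have "\<dots> = (\<integral>\<^sup>+x. \<integral>\<^sup>+y. indicator ?B (T x + y) * g y \<partial>lborel \<partial>lborel)"
    by (rule lborel_pair.Fubini') measurable
  also have "\<dots> = (\<integral>\<^sup>+x. \<integral>\<^sup>+y. indicator ?B y * g (y - T x) \<partial>lborel \<partial>lborel)"
  proof (rule nn_integral_cong)
    fix x
    show "(\<integral>\<^sup>+y. indicator ?B (T x + y) * g y \<partial>lborel) = (\<integral>\<^sup>+y. indicator ?B y * g (y - T x) \<partial>lborel)"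
      using nn_integral_lborel_translate[of "\<lambda>y. indicator ?B y * g (y - T x)" "T x"]
      by (simp add: add.commute)
  qed
  also have "\<dots> = (\<integral>\<^sup>+y. \<integral>\<^sup>+x. indicator ?B y * g (y - T x) \<partial>lborel \<partial>lborel)"
    by (rule lborel_pair.Fubini') measurable
  also have "\<dots> = V * (\<integral>\<^sup>+x. g (- T x) \<partial>lborel)"
    by (simp add: nn_integral_cmult right nn_integral_multc V_def)
  finally show ?thesis
    using V by (simp add: ennreal_mult_cancel_left)
qed

lemma lborel_distr_orthogonal:
  fixes T :: "'a::euclidean_space \<Rightarrow> 'a"
  assumes T: "orthogonal_transformation T"
  shows "distr lborel borel T = lborel"
proof (rule measure_eqI)
  have "linear T"
    using T by (rule orthogonal_transformation_linear)
  then have [measurable]: "T \<in> borel_measurable borel"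
    by (intro borel_measurable_continuous_onI linear_continuous_on) (simp add: linear_conv_bounded_linear)
  have T': "orthogonal_transformation (\<lambda>x. - T x)"
    using T by (simp add: orthogonal_transformation_neg)
  fix A assume "A \<in> sets (distr lborel borel T)"
  then have [measurable]: "A \<in> sets borel" by simp
  have "emeasure (distr lborel borel T) A = (\<integral>\<^sup>+x. indicator A (T x) \<partial>lborel)"
    by (simp add: nn_integral_distr flip: nn_integral_indicator)
  also have "\<dots> = emeasure lborel A"
    using nn_integral_lborel_orthogonal_neg[OF T', of "indicator A"] by simp
  finally show "emeasure (distr lborel borel T) A = emeasure lborel A" .
qed simp

section \<open>The rotation invariant measure on the sphere\<close>

text \<open>
  The cone measure: the mass of a set is the volume of the part of the unit ball lying above it.
  The space is the sphere itself rather than the ambient space, so that continuous functions are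
  bounded on all of it and hence integrable.
\<close>

definition sphere_measure :: "'a::euclidean_space measure" where
  "sphere_measure =
     distr (restrict_space lborel (cball 0 1 - {0})) (restrict_space borel (sphere 0 1)) sgn"

lemma sgn_measurable [measurable]:
  "(sgn :: 'a::euclidean_space \<Rightarrow> 'a) \<in> borel_measurable borel"
  unfolding sgn_div_norm[abs_def] by measurable

lemma space_sphere_measure [simp]: "space sphere_measure = sphere 0 1"
  by (simp add: sphere_measure_def space_restrict_space)

lemma sgn_measurable_punctured_ball:
  "sgn \<in> restrict_space lborel (cball 0 1 - {0 :: 'a::euclidean_space})
     \<rightarrow>\<^sub>M restrict_space borel (sphere 0 1)"
  by (intro measurable_restrict_space2 measurable_restrict_space1)
     (auto simp: space_restrict_space norm_sgn)

lemma emeasure_punctured_ball: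
  "emeasure lborel (cball 0 1 - {0 :: 'a::euclidean_space}) = emeasure lborel (cball (0::'a) 1)"
  by (subst emeasure_Diff) auto

lemma emeasure_sphere_measure:
  "emeasure sphere_measure (sphere (0 :: 'a::euclidean_space) 1) = emeasure lborel (cball (0::'a) 1)"
proof -
  have *: "sphere 0 1 \<in> sets (restrict_space borel (sphere (0::'a) 1))"
    using sets.top[of "restrict_space borel (sphere (0::'a) 1)"] by (simp add: space_restrict_space)
  have "sgn -` sphere 0 1 \<inter> space (restrict_space lborel (cball 0 1 - {0::'a})) = cball 0 1 - {0}"
    by (auto simp: space_restrict_space norm_sgn)
  then show ?thesis
    unfolding sphere_measure_def
    by (subst emeasure_distr[OF sgn_measurable_punctured_ball *])
       (simp_all add: emeasure_restrict_space emeasure_punctured_ball)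
qed

lemma finite_measure_sphere_measure: "finite_measure (sphere_measure :: 'a::euclidean_space measure)"
proof
  show "emeasure sphere_measure (space (sphere_measure :: 'a measure)) \<noteq> \<infinity>"
    using emeasure_lborel_cball_finite[of "0::'a" 1]
    by (simp add: emeasure_sphere_measure)
qed

lemma measure_sphere_measure_pos: "measure sphere_measure (sphere (0 :: 'a::euclidean_space) 1) > 0"
  using content_cball_pos[of 1 "0::'a"] by (simp add: measure_def emeasure_sphere_measure)

lemma ident_measurable_sphere_measure:
  "(\<lambda>x. x) \<in> sphere_measure \<rightarrow>\<^sub>M (borel :: 'a::euclidean_space measure)"
  unfolding sphere_measure_def by (simp add: measurable_restrict_space1)

lemma integrable_sphere_measure:
  fixes F :: "'a::euclidean_space \<Rightarrow> real"
  assumes "continuous_on UNIV F"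
  shows "integrable sphere_measure F"
proof -
  interpret finite_measure "sphere_measure :: 'a measure" by (rule finite_measure_sphere_measure)
  have [measurable]: "F \<in> borel_measurable borel"
    using assms by (rule borel_measurable_continuous_onI)
  have "compact (F ` sphere 0 1)"
    using assms by (intro compact_continuous_image) (auto intro: continuous_on_subset)
  then obtain B where "\<And>x. x \<in> sphere 0 1 \<Longrightarrow> norm (F x) \<le> B"
    by (metis bounded_iff compact_imp_bounded image_eqI)
  then have "AE x in sphere_measure. norm (F x) \<le> B"
    by (intro AE_I2) simp
  moreover have "F \<in> borel_measurable sphere_measure"
    using measurable_compose[OF ident_measurable_sphere_measure, of F borel] by simp
  ultimately show ?thesis by (rule integrable_const_bound)
qed

lemma integral_sphere_measure_lborel:
  fixes F :: "'a::euclidean_space \<Rightarrow> real"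
  assumes [measurable]: "F \<in> borel_measurable borel"
  shows "(\<integral>z. F z \<partial>sphere_measure) = (\<integral>x. indicator (cball 0 1 - {0}) x *\<^sub>R F (sgn x) \<partial>lborel)"
  unfolding sphere_measure_def
  by (subst integral_distr[OF sgn_measurable_punctured_ball])
     (auto simp: integral_restrict_space intro!: measurable_restrict_space1)

lemma integral_sphere_measure_orthogonal:
  fixes F :: "'a::euclidean_space \<Rightarrow> real" and T :: "'a \<Rightarrow> 'a"
  assumes T: "orthogonal_transformation T" and F: "continuous_on UNIV F"
  shows "(\<integral>z. F (T z) \<partial>sphere_measure) = (\<integral>z. F z \<partial>sphere_measure)"
proof -
  have lin: "linear T"
    using T by (rule orthogonal_transformation_linear)
  then have [measurable]: "T \<in> borel_measurable borel"
    by (intro borel_measurable_continuous_onI linear_continuous_on) (simp add: linear_conv_bounded_linear)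
  have [measurable]: "F \<in> borel_measurable borel"
    using F by (rule borel_measurable_continuous_onI)
  have nT: "norm (T x) = norm x" for x
    using T by (simp add: orthogonal_transformation)
  have sT: "sgn (T x) = T (sgn x)" for x
    by (simp add: sgn_div_norm nT linear_cmul[OF lin])
  have iT: "indicator (cball 0 1 - {0}) (T x) = (indicator (cball 0 1 - {0}) x :: real)" for x
  proof -
    have "T x = 0 \<longleftrightarrow> x = 0"
      using nT[of x] by (metis norm_eq_zero)
    then show ?thesis by (simp add: indicator_def nT)
  qed
  have "(\<integral>z. F z \<partial>sphere_measure)
      = (\<integral>x. indicator (cball 0 1 - {0}) x *\<^sub>R F (sgn x) \<partial>distr lborel borel T)"
    by (simp add: integral_sphere_measure_lborel lborel_distr_orthogonal[OF T])
  also have "\<dots> = (\<integral>x. indicator (cball 0 1 - {0}) (T x) *\<^sub>R F (sgn (T x)) \<partial>lborel)"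
  proof (rule integral_distr)
    have [measurable]: "cball 0 1 - {0::'a} \<in> sets borel"
      by (intro sets.Diff) auto
    have [measurable]: "(\<lambda>x. F (sgn x)) \<in> borel_measurable borel"
      by (rule measurable_compose[OF sgn_measurable]) measurable
    show "(\<lambda>x. indicator (cball 0 1 - {0}) x *\<^sub>R F (sgn x)) \<in> borel_measurable borel"
      by measurable
  qed simp
  also have "\<dots> = (\<integral>z. F (T z) \<partial>sphere_measure)"
    by (simp add: integral_sphere_measure_lborel iT sT)
  finally show ?thesis ..
qed

text \<open>
  The integrand is bounded on the compact product of spheres, so it is integrable for the product
  measure.
\<close>

lemma sphere_measure_Fubini:
  fixes F :: "'a::euclidean_space \<Rightarrow> 'a \<Rightarrow> real"
  assumes F: "continuous_on UNIV (\<lambda>(x, y). F x y)"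
  shows "(\<integral>x. (\<integral>y. F x y \<partial>sphere_measure) \<partial>sphere_measure)
       = (\<integral>y. (\<integral>x. F x y \<partial>sphere_measure) \<partial>sphere_measure)"
proof -
  interpret finite_measure "sphere_measure :: 'a measure" by (rule finite_measure_sphere_measure)
  interpret P: pair_sigma_finite "sphere_measure :: 'a measure" "sphere_measure :: 'a measure" ..
  interpret PF: finite_measure "sphere_measure \<Otimes>\<^sub>M sphere_measure :: ('a \<times> 'a) measure"
    by (intro finite_measure_pair_measure finite_measure_sphere_measure)
  have [measurable]: "(\<lambda>(x, y). F x y) \<in> borel_measurable (borel :: ('a \<times> 'a) measure)"
    using F by (rule borel_measurable_continuous_onI)
  have "(\<lambda>p. p) \<in> sphere_measure \<Otimes>\<^sub>M sphere_measure \<rightarrow>\<^sub>M (borel :: ('a \<times> 'a) measure)"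
    unfolding borel_prod[symmetric]
    using measurable_Pair[OF measurable_compose[OF measurable_fst ident_measurable_sphere_measure]
        measurable_compose[OF measurable_snd ident_measurable_sphere_measure]]
    by simp
  then have meas: "(\<lambda>(x, y). F x y) \<in> borel_measurable (sphere_measure \<Otimes>\<^sub>M sphere_measure)"
    using measurable_compose[of "\<lambda>p. p" _ borel "\<lambda>(x, y). F x y" borel] by simp
  have "compact ((\<lambda>(x, y). F x y) ` (sphere 0 1 \<times> sphere 0 1))"
    using F by (intro compact_continuous_image compact_Times) (auto intro: continuous_on_subset)
  then obtain B where "\<And>p. p \<in> sphere 0 1 \<times> sphere 0 1 \<Longrightarrow> norm ((\<lambda>(x, y). F x y) p) \<le> B"
    by (metis bounded_iff compact_imp_bounded image_eqI)
  then have "AE p in sphere_measure \<Otimes>\<^sub>M sphere_measure. norm ((\<lambda>(x, y). F x y) p) \<le> B"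
    by (intro AE_I2) (simp add: space_pair_measure)
  then have "integrable (sphere_measure \<Otimes>\<^sub>M sphere_measure) (\<lambda>(x, y). F x y)"
    using meas by (rule PF.integrable_const_bound)
  then show ?thesis by (rule P.Fubini_integral[symmetric])
qed

section \<open>Moments of the ultraspherical weight\<close>

text \<open>
  The substitution \<open>t = (x + 1) / 2\<close> turns the weight into a multiple of a Beta integrand.
\<close>

lemma ultraspherical_weight_integrable:
  assumes "n \<ge> 2"
  obtains m where "m > 0" "((\<lambda>x. (1 - x\<^sup>2) powr ((real n - 3) / 2)) has_integral m) {-1..1}"
proof -
  define a where "a = (real n - 1) / 2"
  have a: "a > 0" "a - 1 = (real n - 3) / 2"
    using assms by (auto simp: a_def field_simps)
  have "((\<lambda>t. t powr (a - 1) * (1 - t) powr (a - 1)) has_integral Beta a a) (cbox 0 1)"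
    using has_integral_Beta_real[OF a(1) a(1)] by simp
  from has_integral_affinity[OF this, of "1/2" "1/2"]
  have "((\<lambda>x. ((x + 1) / 2) powr (a - 1) * (1 - (x + 1) / 2) powr (a - 1)) has_integral 2 * Beta a a)
      ((\<lambda>x. 2 * x - 1) ` {0..1})"
    by (simp add: add_divide_distrib diff_divide_distrib)
  moreover have "(\<lambda>x. 2 * x - 1) ` {0..1} = {-1..1::real}"
    using image_affinity_atLeastAtMost_diff[of 2 1 0 "1::real"] by simp
  ultimately have "((\<lambda>x. ((x + 1) / 2) powr (a - 1) * (1 - (x + 1) / 2) powr (a - 1))
      has_integral 2 * Beta a a) {-1..1}"
    by simp
  from has_integral_mult_right[OF this, of "4 powr (a - 1)"]
  have "((\<lambda>x. 4 powr (a - 1) * (((x + 1) / 2) powr (a - 1) * (1 - (x + 1) / 2) powr (a - 1)))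
      has_integral 4 powr (a - 1) * (2 * Beta a a)) {-1..1}" .
  moreover have "4 powr (a - 1) * (((x + 1) / 2) powr (a - 1) * (1 - (x + 1) / 2) powr (a - 1))
      = (1 - x\<^sup>2) powr (a - 1)" if "x \<in> {-1..1}" for x :: real
  proof -
    have "1 - x\<^sup>2 = 4 * ((x + 1) / 2 * (1 - (x + 1) / 2))"
      by (simp add: power2_eq_square field_simps)
    moreover have "(x + 1) / 2 \<ge> 0" "1 - (x + 1) / 2 \<ge> 0"
      using that by auto
    ultimately show ?thesis
      by (simp only: powr_mult mult_nonneg_nonneg zero_le_numeral)
  qed
  ultimately have "((\<lambda>x. (1 - x\<^sup>2) powr (a - 1)) has_integral 4 powr (a - 1) * (2 * Beta a a)) {-1..1}"
    by (rule has_integral_eq[rotated])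
  moreover have "Beta a a > 0"
    using a(1) by (simp add: Beta_def Gamma_real_pos)
  ultimately show ?thesis
    by (intro that[of "4 powr (a - 1) * (2 * Beta a a)"]) (simp_all add: a(2))
qed

text \<open>
  The integrand is the derivative of \<open>x ^ k * (1 - x\<^sup>2) powr ((n - 1) / 2)\<close>, which vanishes at both
  ends of the interval. The cofactor of the weight in that derivative is a polynomial, so this relates the moments of order
  \<open>k - 1\<close> and \<open>k + 1\<close> of the weight; for \<open>k = 0\<close> the first moment vanishes.
\<close>

lemma ultraspherical_weight_boundary:
  assumes n: "n \<ge> 2"
  shows "((\<lambda>x. (real k * x ^ (k - 1) * (1 - x\<^sup>2) - real (n - 1) * x ^ (k + 1))
            * (1 - x\<^sup>2) powr ((real n - 3) / 2)) has_integral 0) {-1..1}"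
proof -
  define b where "b = (real n - 1) / 2"
  have b: "b > 0" "b - 1 = (real n - 3) / 2" "2 * b = real (n - 1)"
    using n by (auto simp: b_def field_simps of_nat_diff)
  have "((\<lambda>x. (real k * x ^ (k - 1) * (1 - x\<^sup>2) - real (n - 1) * x ^ (k + 1))
            * (1 - x\<^sup>2) powr ((real n - 3) / 2)) has_integral
        1 ^ k * (1 - 1\<^sup>2) powr b - (-1) ^ k * (1 - (-1)\<^sup>2) powr b) {-1..1}"
  proof (rule fundamental_theorem_of_calculus_interior)
    show "continuous_on {-1..1} (\<lambda>x::real. x ^ k * (1 - x\<^sup>2) powr b)"
      using b(1) by (intro continuous_intros continuous_on_powr') (auto simp: abs_square_le_1 abs_le_iff)
    fix x :: real assume "x \<in> {-1<..<1}"
    then have x: "1 - x\<^sup>2 > 0"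
      by (simp add: abs_square_less_1 abs_less_iff)
    have e: "(1 - x\<^sup>2) powr b = (1 - x\<^sup>2) powr (b - 1) * (1 - x\<^sup>2)"
      using x by (simp add: powr_diff)
    have "((\<lambda>x. x ^ k * (1 - x\<^sup>2) powr b) has_real_derivative
        (real k * x ^ (k - 1)) * (1 - x\<^sup>2) powr b + (b * (1 - x\<^sup>2) powr (b - 1) * (- 2 * x)) * x ^ k) (at x)"
      using x by (auto intro!: derivative_eq_intros simp: powr_diff field_simps)
    also have "(real k * x ^ (k - 1)) * (1 - x\<^sup>2) powr b + (b * (1 - x\<^sup>2) powr (b - 1) * (- 2 * x)) * x ^ k
      = (real k * x ^ (k - 1) * (1 - x\<^sup>2) - (2 * b) * x ^ (k + 1)) * (1 - x\<^sup>2) powr (b - 1)"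
      unfolding e by (simp add: algebra_simps)
    finally show "((\<lambda>x. x ^ k * (1 - x\<^sup>2) powr b) has_vector_derivative
        (real k * x ^ (k - 1) * (1 - x\<^sup>2) - real (n - 1) * x ^ (k + 1)) * (1 - x\<^sup>2) powr ((real n - 3) / 2)) (at x)"
      by (simp only: b has_real_derivative_iff_has_vector_derivative)
  qed simp
  then show ?thesis by simp
qed

text \<open>
  The recurrence \<open>rec\<close> and the first two values determine a moment sequence up to a factor, and
  the moments of the weight satisfy it. Integrability for the weight comes out of the same
  induction.
\<close>

lemma ultraspherical_moments:
  assumes n: "n \<ge> 2" and \<mu>0: "\<mu> 0 > 0" and \<mu>1: "\<mu> 1 = 0"
    and rec: "\<And>k. real (n + k) * \<mu> (k + 2) = real (k + 1) * \<mu> k"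
  obtains C where "C > 0"
    "\<And>p. ((\<lambda>x. poly p x * (1 - x\<^sup>2) powr ((real n - 3) / 2)) has_integral
            C * (\<Sum>i\<le>degree p. coeff p i * \<mu> i)) {-1..1}"
proof -
  let ?w = "\<lambda>x::real. (1 - x\<^sup>2) powr ((real n - 3) / 2)"
  obtain m where m: "m > 0" "(?w has_integral m) {-1..1}"
    using ultraspherical_weight_integrable[OF n] .
  define C where "C = m / \<mu> 0"
  have C: "C > 0" using m \<mu>0 by (simp add: C_def)
  have mom: "((\<lambda>x. x ^ k * ?w x) has_integral C * \<mu> k) {-1..1}" for k
  proof (induction k rule: induct_nat_012)
    case 0
    then show ?case using m(2) \<mu>0 by (simp add: C_def)
  next
    case 1
    define r where "r = real (n - 1)"
    have r: "r \<noteq> 0" using n by (simp add: r_def)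
    have "((\<lambda>x. - r * (x * ?w x)) has_integral 0) {-1..1}"
      using ultraspherical_weight_boundary[OF n, of 0] by (simp only: r_def) (simp add: mult.assoc)
    from has_integral_mult_right[OF this, of "- 1 / r"]
    show ?case using r \<mu>1 by simp
  next
    case (ge2 k)
    have "((\<lambda>x. (real (k + 1) * x ^ k * (1 - x\<^sup>2) - real (n - 1) * x ^ (k + 2)) * ?w x) has_integral 0) {-1..1}"
      using ultraspherical_weight_boundary[OF n, of "k + 1"] by simp
    from has_integral_diff[OF has_integral_mult_right[OF ge2(1), of "real (k + 1)"] this]
    have "((\<lambda>x. real (n + k) * (x ^ (k + 2) * ?w x)) has_integral real (k + 1) * (C * \<mu> k)) {-1..1}"
      using n by (simp add: algebra_simps of_nat_diff power2_eq_square)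
    from has_integral_mult_right[OF this, of "1 / real (n + k)"]
    have "((\<lambda>x. x ^ (k + 2) * ?w x) has_integral real (k + 1) * (C * \<mu> k) / real (n + k)) {-1..1}"
      using n by simp
    also have "real (k + 1) * (C * \<mu> k) / real (n + k) = C * \<mu> (k + 2)"
      using rec[of k] n by (simp add: field_simps)
    finally show ?case by simp
  qed
  have "((\<lambda>x. poly p x * ?w x) has_integral C * (\<Sum>i\<le>degree p. coeff p i * \<mu> i)) {-1..1}" for p
  proof -
    have "((\<lambda>x. \<Sum>i\<le>degree p. coeff p i * (x ^ i * ?w x)) has_integral
        (\<Sum>i\<le>degree p. coeff p i * (C * \<mu> i))) {-1..1}"
      by (intro has_integral_sum has_integral_mult_right mom) auto
    then show ?thesis
      by (simp add: poly_altdef sum_distrib_left sum_distrib_right mult_ac)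
  qed
  with C show ?thesis using that by blast
qed

text \<open>
  The endpoints, where (by \<open>0 powr a = 0\<close>) the weight may be discontinuous, are avoided: it is
  enough that the continuous integrand vanishes on a smaller interval, since this gives infinitely
  many roots.
\<close>

lemma ultraspherical_weight_definite:
  fixes p :: "real poly"
  assumes 0: "((\<lambda>x. poly (p * p) x * (1 - x\<^sup>2) powr ((real n - 3) / 2)) has_integral 0) {-1..1}"
  shows "p = 0"
proof -
  let ?h = "\<lambda>x::real. poly (p * p) x * (1 - x\<^sup>2) powr ((real n - 3) / 2)"
  have nn: "?h x \<ge> 0" for x by simp
  have sub: "{-1/2..1/2} \<subseteq> {-1..1::real}" by auto
  have int: "?h integrable_on {-1/2..1/2}"
    using integrable_on_subinterval[OF has_integral_integrable[OF 0] sub] .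
  have "integral {-1/2..1/2} ?h \<le> integral {-1..1} ?h"
    using sub int 0 nn by (intro integral_subset_le) auto
  also have "\<dots> = 0" using 0 by (rule integral_unique)
  finally have "integral {-1/2..1/2} ?h = 0"
    using integral_nonneg[OF int] nn by (intro antisym) blast+
  with integrable_integral[OF int] have hi: "(?h has_integral 0) (cbox (-1/2) (1/2))"
    by (simp only: cbox_interval)
  have sq: "1 - x\<^sup>2 > 0" if "x \<in> {-1/2..1/2}" for x :: real
  proof -
    have "\<bar>x\<bar> < 1" using that by auto
    then show ?thesis by (simp add: abs_square_less_1)
  qed
  have "continuous_on (cbox (-1/2) (1/2)) ?h"
  proof (intro continuous_intros ballI)
    fix x :: real assume "x \<in> cbox (-1/2) (1/2)"
    with sq[of x] show "1 - x\<^sup>2 \<noteq> 0" by simp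
  qed
  then have z: "?h x = 0" if "x \<in> {-1/2..1/2}" for x
    using has_integral_0_cbox_imp_0[OF _ _ hi, of x] that nn by simp
  have "poly p x = 0" if "x \<in> {-1/2..1/2}" for x
    using z[OF that] sq[OF that] by simp
  then have "{-1/2..1/2} \<subseteq> {x. poly p x = 0}" by auto
  moreover have "infinite {-1/2..1/2::real}" by (simp add: infinite_Icc)
  ultimately show ?thesis
    using poly_roots_finite[of p] finite_subset by blast
qed

section \<open>Zonal functions on the sphere\<close>

lemma orthogonal_transformation_reflection:
  "orthogonal_transformation (\<lambda>x :: 'a::euclidean_space. x - (2 * (x \<bullet> v) / (v \<bullet> v)) *\<^sub>R v)"
proof (cases "v = 0")
  case True
  then show ?thesis by (simp add: orthogonal_transformation_id)
next
  case False
  then show ?thesis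
    unfolding orthogonal_transformation_def
    by (intro conjI allI linearI)
       (simp_all add: algebra_simps add_divide_distrib inner_commute)
qed

text \<open>
  The vector that is reflected away is the difference of the two points, so that the mirror is
  their perpendicular bisector.
\<close>

lemma reflection_swaps:
  fixes a b :: "'a::euclidean_space"
  assumes "norm a = norm b"
  shows "a - (2 * (a \<bullet> (a - b)) / ((a - b) \<bullet> (a - b))) *\<^sub>R (a - b) = b"
proof (cases "a = b")
  case False
  have "a \<bullet> a = b \<bullet> b"
    using assms by (simp add: dot_square_norm)
  then have "2 * (a \<bullet> (a - b)) = (a - b) \<bullet> (a - b)"
    by (simp add: algebra_simps inner_commute)
  moreover have "(a - b) \<bullet> (a - b) \<noteq> 0"
    using False by simp
  ultimately have "2 * (a \<bullet> (a - b)) / ((a - b) \<bullet> (a - b)) = 1"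
    by (metis divide_self)
  then show ?thesis by (simp only: scaleR_one) simp
qed simp

text \<open>
  A first reflection takes \<open>a\<close> to \<open>a'\<close>. A second one takes the image of \<open>b\<close> to \<open>b'\<close>; it fixes
  \<open>a'\<close> because both points have the same inner product with \<open>a'\<close>, so that \<open>a'\<close> lies in the
  mirror.
\<close>

lemma orthogonal_transformation_pair_exists:
  fixes a b a' b' :: "'a::euclidean_space"
  assumes "norm a = norm a'" "norm b = norm b'" "a \<bullet> b = a' \<bullet> b'"
  obtains T :: "'a \<Rightarrow> 'a" where "orthogonal_transformation T" "T a = a'" "T b = b'"
proof -
  define R where "R v x = x - (2 * (x \<bullet> v) / (v \<bullet> v)) *\<^sub>R v" for v x :: 'a
  have R: "orthogonal_transformation (R v)" for v
    unfolding R_def by (rule orthogonal_transformation_reflection)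
  define c where "c = R (a - a') b"
  have Ra: "R (a - a') a = a'"
    unfolding R_def using assms(1) by (rule reflection_swaps)
  have "norm c = norm b'"
    using R[of "a - a'"] assms(2) by (simp add: c_def orthogonal_transformation)
  then have Rc: "R (c - b') c = b'"
    unfolding R_def by (rule reflection_swaps)
  have "a' \<bullet> c = a \<bullet> b"
    using R[of "a - a'"] Ra by (metis c_def orthogonal_transformation_def)
  then have "a' \<bullet> (c - b') = 0"
    using assms(3) by (simp add: inner_diff_right)
  then have Ra': "R (c - b') a' = a'"
    by (simp add: R_def)
  show ?thesis
  proof (rule that)
    show "orthogonal_transformation (R (c - b') \<circ> R (a - a'))"
      by (intro orthogonal_transformation_compose R)
  qed (use Ra Ra' Rc c_def in auto)
qed

text \<open>
  This is the form in which rotation invariance is used below.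
\<close>

lemma integral_sphere_measure_pair_cong:
  fixes a b a' b' :: "'a::euclidean_space" and H :: "real \<Rightarrow> real \<Rightarrow> real"
  assumes ab: "norm a = norm a'" "norm b = norm b'" "a \<bullet> b = a' \<bullet> b'"
    and H: "continuous_on UNIV (\<lambda>(s, t). H s t)"
  shows "(\<integral>z. H (a \<bullet> z) (b \<bullet> z) \<partial>sphere_measure) = (\<integral>z. H (a' \<bullet> z) (b' \<bullet> z) \<partial>sphere_measure)"
proof -
  obtain T :: "'a \<Rightarrow> 'a" where T: "orthogonal_transformation T" "T a = a'" "T b = b'"
    using orthogonal_transformation_pair_exists[OF ab] .
  have inner: "a' \<bullet> T z = a \<bullet> z" "b' \<bullet> T z = b \<bullet> z" for z
    using T by (auto simp: orthogonal_transformation_def)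
  have "continuous_on UNIV (\<lambda>z. (\<lambda>(s, t). H s t) (a' \<bullet> z, b' \<bullet> z))"
    by (rule continuous_on_compose2[OF H]) (auto intro!: continuous_intros)
  then have "continuous_on UNIV (\<lambda>z. H (a' \<bullet> z) (b' \<bullet> z))" by simp
  from integral_sphere_measure_orthogonal[OF T(1) this] show ?thesis
    by (simp add: inner)
qed

text \<open>
  By rotation invariance any unit vector may serve as the axis.
\<close>

definition sphere_moment :: "'a::euclidean_space itself \<Rightarrow> nat \<Rightarrow> real" where
  "sphere_moment _ k = (\<integral>z. ((SOME e::'a. e \<in> Basis) \<bullet> z) ^ k \<partial>sphere_measure)"

lemma integral_inner_power:
  fixes a :: "'a::euclidean_space"
  shows "(\<integral>z. (a \<bullet> z) ^ k \<partial>sphere_measure) = norm a ^ k * sphere_moment TYPE('a) k"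
proof -
  define e where "e = (SOME e::'a. e \<in> Basis)"
  have "e \<in> Basis" unfolding e_def by (simp add: some_in_eq)
  then have "norm e = 1" by simp
  then have "(\<integral>z. (a \<bullet> z) ^ k \<partial>sphere_measure) = (\<integral>z. ((norm a *\<^sub>R e) \<bullet> z) ^ k \<partial>sphere_measure)"
    by (intro integral_sphere_measure_pair_cong[of a _ 0 0 "\<lambda>s t. s ^ k"])
       (auto simp: split_beta intro!: continuous_intros)
  then show ?thesis
    by (simp add: power_mult_distrib sphere_moment_def e_def)
qed

lemma sphere_moment_0: "sphere_moment TYPE('a::euclidean_space) 0 > 0"
  using measure_sphere_measure_pos[where 'a='a] by (simp add: sphere_moment_def)

lemma sphere_moment_odd:
  assumes "odd k"
  shows "sphere_moment TYPE('a::euclidean_space) k = 0"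
proof -
  obtain e :: 'a where e: "e \<in> Basis" using nonempty_Basis by blast
  have "(\<integral>z. (e \<bullet> z) ^ k \<partial>sphere_measure) = (\<integral>z. ((- e) \<bullet> z) ^ k \<partial>sphere_measure)"
    by (simp only: integral_inner_power norm_minus_cancel)
  then show ?thesis
    using assms e by (simp add: integral_inner_power)
qed

text \<open>
  The two lower coefficients are needed to carry the induction for the third.
\<close>

lemma coeff_power_one_plus_square: "coeff ([:1, 0, 1:] ^ j) 0 = (1::real)" "coeff ([:1, 0, 1:] ^ j) (Suc 0) = (0::real)"
    "coeff ([:1, 0, 1:] ^ j) (Suc (Suc 0)) = (of_nat j :: real)"
  by (induction j) (auto simp: coeff_pCons)

text \<open>
  For odd exponents both sides vanish by reflection. For even ones, the integral of
  \<open>((a + s *\<^sub>R b) \<bullet> z) ^ (k + 2)\<close> is the moment times \<open>norm (a + s *\<^sub>R b) ^ (k + 2)\<close>, that is, times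
  \<open>(1 + s\<^sup>2) ^ ((k + 2) div 2)\<close>. Both sides are polynomials in \<open>s\<close>, and the claim compares their
  coefficients of \<open>s\<^sup>2\<close>.
\<close>

lemma sphere_moment_mixed:
  fixes a b :: "'a::euclidean_space"
  assumes ab: "norm a = 1" "norm b = 1" "a \<bullet> b = 0"
  shows "real (k + 1) * (\<integral>z. (a \<bullet> z) ^ k * (b \<bullet> z)\<^sup>2 \<partial>sphere_measure) = sphere_moment TYPE('a) (k + 2)"
proof (cases "even k")
  case False
  have "(\<integral>z. (a \<bullet> z) ^ k * (b \<bullet> z)\<^sup>2 \<partial>sphere_measure) = (\<integral>z. ((- a) \<bullet> z) ^ k * (b \<bullet> z)\<^sup>2 \<partial>sphere_measure)"
    using ab by (intro integral_sphere_measure_pair_cong[of a "- a" b b "\<lambda>s t. s ^ k * t\<^sup>2"])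
       (auto simp: split_beta intro!: continuous_intros)
  then have "(\<integral>z. (a \<bullet> z) ^ k * (b \<bullet> z)\<^sup>2 \<partial>sphere_measure) = 0"
    using False by simp
  then show ?thesis using False by (simp add: sphere_moment_odd)
next
  case True
  then obtain j where j: "k + 2 = 2 * j" by (metis dvdE even_add even_numeral)
  define M where "M q = (\<integral>z. (a \<bullet> z) ^ (k + 2 - q) * (b \<bullet> z) ^ q \<partial>sphere_measure)" for q
  define P where "P = (\<Sum>q\<le>k + 2. monom (of_nat (k + 2 choose q) * M q) q)"
  define Q where "Q = smult (sphere_moment TYPE('a) (k + 2)) ([:1, 0, 1:] ^ j)"
  have "poly P s = poly Q s" for s
  proof -
    have "norm (a + s *\<^sub>R b) ^ 2 = 1 + s\<^sup>2"
      unfolding power2_norm_eq_inner using ab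
      by (simp add: inner_add_left inner_add_right inner_commute norm_eq_1 power2_eq_square)
    then have "norm (a + s *\<^sub>R b) ^ (k + 2) = (1 + s\<^sup>2) ^ j"
      unfolding j power_mult by simp
    then have "poly Q s = (\<integral>z. ((a + s *\<^sub>R b) \<bullet> z) ^ (k + 2) \<partial>sphere_measure)"
      unfolding integral_inner_power Q_def by (simp add: power2_eq_square)
    also have "\<dots> = (\<integral>z. (\<Sum>q\<le>k + 2. of_nat (k + 2 choose q) * s ^ q * ((a \<bullet> z) ^ (k + 2 - q) * (b \<bullet> z) ^ q)) \<partial>sphere_measure)"
    proof (rule Bochner_Integration.integral_cong[OF refl])
      fix z
      have "((a + s *\<^sub>R b) \<bullet> z) ^ (k + 2) = (s * (b \<bullet> z) + a \<bullet> z) ^ (k + 2)"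
        by (simp add: inner_add_left add.commute)
      also have "\<dots> = (\<Sum>q\<le>k + 2. of_nat (k + 2 choose q) * s ^ q * ((a \<bullet> z) ^ (k + 2 - q) * (b \<bullet> z) ^ q))"
        unfolding binomial_ring by (simp add: power_mult_distrib mult_ac)
      finally show "((a + s *\<^sub>R b) \<bullet> z) ^ (k + 2)
        = (\<Sum>q\<le>k + 2. of_nat (k + 2 choose q) * s ^ q * ((a \<bullet> z) ^ (k + 2 - q) * (b \<bullet> z) ^ q))" .
    qed
    also have "\<dots> = (\<Sum>q\<le>k + 2. of_nat (k + 2 choose q) * s ^ q * M q)"
      unfolding M_def
      by (subst Bochner_Integration.integral_sum)
         (auto intro!: integrable_sphere_measure continuous_intros)
    also have "\<dots> = poly P s"
      by (simp add: P_def poly_sum poly_monom mult_ac)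
    finally show ?thesis ..
  qed
  then have "P = Q" by (simp add: poly_eq_poly_eq_iff[symmetric] fun_eq_iff) 
  then have "coeff P 2 = coeff Q 2" by simp
  moreover have "coeff P 2 = of_nat (k + 2 choose 2) * M 2"
    unfolding P_def coeff_sum coeff_monom by (subst sum.delta) (simp_all only: finite_atMost, simp)
  moreover have "coeff Q 2 = sphere_moment TYPE('a) (k + 2) * real j"
    by (simp add: Q_def numeral_2_eq_2 coeff_power_one_plus_square)
  moreover have "real (k + 2 choose 2) = real j * real (k + 1)"
  proof -
    have "(k + 2 choose 2) = j * (k + 1)"
    proof -
      have "k + 1 = 2 * j - 1" using j by simp
      then show ?thesis using j unfolding choose_two by simp
    qed
    then show ?thesis by (simp only: of_nat_mult)
  qed
  ultimately have "real j * (real (k + 1) * M 2) = real j * sphere_moment TYPE('a) (k + 2)"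
    by (simp add: mult_ac)
  moreover have "j \<noteq> 0" using j by auto
  ultimately show ?thesis by (simp add: M_def)
qed

text \<open>
  Multiply \<open>(e \<bullet> z) ^ k\<close> by \<open>1 = (\<Sum>c\<in>Basis. (c \<bullet> z)\<^sup>2)\<close>. The summand for \<open>c = e\<close> gives the moment of
  order \<open>k + 2\<close>, and the others are mixed moments along orthonormal pairs.
\<close>

lemma sphere_moment_rec:
  "real (DIM('a) + k) * sphere_moment TYPE('a::euclidean_space) (k + 2) = real (k + 1) * sphere_moment TYPE('a) k"
proof -
  obtain e :: 'a where e: "e \<in> Basis" using nonempty_Basis by blast
  define X where "X c = (\<integral>z. (e \<bullet> z) ^ k * (c \<bullet> z)\<^sup>2 \<partial>sphere_measure)" for c :: 'a
  have "sphere_moment TYPE('a) k = (\<integral>z. (e \<bullet> z) ^ k \<partial>sphere_measure)"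
    using e by (simp add: integral_inner_power)
  also have "\<dots> = (\<integral>z. (\<Sum>c\<in>Basis. (e \<bullet> z) ^ k * (c \<bullet> z)\<^sup>2) \<partial>sphere_measure)"
  proof (rule Bochner_Integration.integral_cong[OF refl])
    fix z :: 'a assume "z \<in> space sphere_measure"
    then have "z \<bullet> z = 1" by (simp add: norm_eq_1)
    then have "(\<Sum>c\<in>Basis. (c \<bullet> z)\<^sup>2) = 1"
      by (simp add: euclidean_inner[of z z] power2_eq_square inner_commute)
    then show "(e \<bullet> z) ^ k = (\<Sum>c\<in>Basis. (e \<bullet> z) ^ k * (c \<bullet> z)\<^sup>2)"
      by (simp flip: sum_distrib_left)
  qed
  also have "\<dots> = (\<Sum>c\<in>Basis. X c)"
    unfolding X_def
    by (subst Bochner_Integration.integral_sum) (auto intro!: integrable_sphere_measure continuous_intros)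
  also have "\<dots> = X e + (\<Sum>c\<in>Basis - {e}. X c)"
    using e by (simp add: sum.remove)
  also have "X e = sphere_moment TYPE('a) (k + 2)"
    unfolding X_def power_add[symmetric] using e by (simp only: integral_inner_power norm_Basis) simp
  finally have "real (k + 1) * sphere_moment TYPE('a) k = real (k + 1) * sphere_moment TYPE('a) (k + 2)
      + (\<Sum>c\<in>Basis - {e}. real (k + 1) * X c)"
    by (simp add: distrib_left sum_distrib_left)
  also have "(\<Sum>c\<in>Basis - {e}. real (k + 1) * X c) = (\<Sum>c\<in>Basis - {e}. sphere_moment TYPE('a) (k + 2))"
  proof (rule sum.cong[OF refl])
    fix c assume "c \<in> Basis - {e}"
    then show "real (k + 1) * X c = sphere_moment TYPE('a) (k + 2)"
      unfolding X_def using e by (intro sphere_moment_mixed) (auto simp: inner_Basis)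
  qed
  also have "\<dots> = (real DIM('a) - 1) * sphere_moment TYPE('a) (k + 2)"
    using e by (simp add: of_nat_diff Suc_leI)
  finally show ?thesis by (simp add: algebra_simps)
qed

text \<open>
  The projection of the sphere to an axis has density proportional to the weight. The recurrences
  for the moments on both sides coincide, so the proof needs no slicing of the sphere.
\<close>

lemma integral_zonal_poly:
  assumes "DIM('a::euclidean_space) \<ge> 2"
  obtains C where "C > 0"
    "\<And>(a::'a) p. norm a = 1 \<Longrightarrow>
       ((\<lambda>x. poly p x * (1 - x\<^sup>2) powr ((real DIM('a) - 3) / 2)) has_integral
          C * (\<integral>z. poly p (a \<bullet> z) \<partial>sphere_measure)) {-1..1}"
proof -
  obtain C where C: "C > 0"
    "\<And>p. ((\<lambda>x. poly p x * (1 - x\<^sup>2) powr ((real DIM('a) - 3) / 2)) has_integral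
            C * (\<Sum>i\<le>degree p. coeff p i * sphere_moment TYPE('a) i)) {-1..1}"
  proof (rule ultraspherical_moments[OF assms, where \<mu> = "sphere_moment TYPE('a)"])
    show "sphere_moment TYPE('a) 0 > 0" by (rule sphere_moment_0)
    show "sphere_moment TYPE('a) 1 = 0" by (rule sphere_moment_odd) simp
    show "real (DIM('a) + k) * sphere_moment TYPE('a) (k + 2) = real (k + 1) * sphere_moment TYPE('a) k" for k
      by (rule sphere_moment_rec)
  qed blast
  have "(\<integral>z. poly p (a \<bullet> z) \<partial>sphere_measure) = (\<Sum>i\<le>degree p. coeff p i * sphere_moment TYPE('a) i)"
    if "norm a = 1" for a :: 'a and p
    unfolding poly_altdef using that
    by (subst Bochner_Integration.integral_sum)
       (auto simp: integral_inner_power intro!: integrable_sphere_measure continuous_intros)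
  then show ?thesis using that[of C] C by simp
qed

text \<open>
  Choose an orthonormal pair \<open>e\<close>, \<open>c\<close> and put \<open>u = a \<bullet> b\<close>. The pair \<open>a\<close>, \<open>b\<close> can be rotated to \<open>e\<close> and
  \<open>u *\<^sub>R e + sqrt (1 - u\<^sup>2) *\<^sub>R c\<close>. Expanding \<open>p\<close> at the second point gives powers of
  \<open>sqrt (1 - u\<^sup>2)\<close>; the odd ones have coefficient zero by reflection of \<open>c\<close>, and the even ones are
  polynomials in \<open>u\<close>. The bound on the degree of \<open>R\<close> is what lets orthogonality to
  lower degrees pass through a convolution.
\<close>

lemma zonal_convolution_poly:
  fixes g :: "real \<Rightarrow> real" and p :: "real poly"
  assumes dim: "DIM('a::euclidean_space) \<ge> 2" and g: "continuous_on UNIV g"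
  obtains R where "degree R \<le> degree p"
    "\<And>a b::'a. norm a = 1 \<Longrightarrow> norm b = 1 \<Longrightarrow>
       (\<integral>z. g (a \<bullet> z) * poly p (b \<bullet> z) \<partial>sphere_measure) = poly R (a \<bullet> b)"
proof -
  obtain e c :: 'a where ec: "e \<in> Basis" "c \<in> Basis" "e \<noteq> c"
    using dim card_le_Suc0_iff_eq[of "Basis :: 'a set"] by fastforce
  have gc: "continuous_on UNIV (\<lambda>x. g (f x))" if "continuous_on UNIV f" for f :: "'b::topological_space \<Rightarrow> real"
    using continuous_on_compose2[OF g that] by simp
  define A where "A j r = (\<integral>z. g (e \<bullet> z) * (e \<bullet> z) ^ (j - r) * (c \<bullet> z) ^ r \<partial>sphere_measure)" for j r
  have A_odd: "A j r = 0" if "odd r" for j r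
  proof -
    have "A j r = (\<integral>z. g (e \<bullet> z) * (e \<bullet> z) ^ (j - r) * ((- c) \<bullet> z) ^ r \<partial>sphere_measure)"
      unfolding A_def using ec
      by (intro integral_sphere_measure_pair_cong[of e e c "- c" "\<lambda>s t. g s * s ^ (j - r) * t ^ r"])
         (auto simp: split_beta inner_Basis intro!: continuous_intros gc)
    also have "\<dots> = - A j r"
      using that by (simp add: A_def)
    finally show ?thesis by simp
  qed
  \<comment> \<open>The term of order \<open>r\<close> in the expansion of the \<open>j\<close>-th power, with \<open>sqrt (1 - u\<^sup>2) ^ r\<close>
    written as \<open>(1 - u\<^sup>2) ^ (r div 2)\<close> for even \<open>r\<close>.\<close>
  define S :: "nat \<Rightarrow> nat \<Rightarrow> real poly" where
    "S j r = (if even r then smult (of_nat (j choose r) * A j r) ([:0, 1:] ^ (j - r) * [:1, 0, -1:] ^ (r div 2)) else 0)"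
    for j r
  define R where "R = (\<Sum>j\<le>degree p. smult (coeff p j) (\<Sum>r\<le>j. S j r))"
  have deg_S: "degree (S j r) \<le> j" if "r \<le> j" for j r
  proof (cases "even r")
    case True
    have "degree ([:0, 1:] ^ (j - r) * [:1, 0, -1:] ^ (r div 2) :: real poly)
        \<le> degree ([:0, 1::real:] ^ (j - r)) + degree ([:1, 0, -1::real:] ^ (r div 2))"
      by (rule degree_mult_le)
    also have "\<dots> \<le> (j - r) * 1 + (r div 2) * 2"
      by (simp add: degree_power_eq)
    also have "\<dots> = j" using True that by simp
    finally show ?thesis
      using True by (auto simp: S_def intro: order_trans[OF degree_smult_le])
  qed (simp add: S_def)
  have "degree R \<le> degree p"
    unfolding R_def
  proof (rule degree_sum_le)
    fix j assume "j \<in> {..degree p}"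
    then have "degree (\<Sum>r\<le>j. S j r) \<le> degree p"
      using deg_S by (intro degree_sum_le) (auto intro: le_trans)
    then show "degree (smult (coeff p j) (\<Sum>r\<le>j. S j r)) \<le> degree p"
      using degree_smult_le le_trans by blast
  qed simp
  moreover have "(\<integral>z. g (a \<bullet> z) * poly p (b \<bullet> z) \<partial>sphere_measure) = poly R (a \<bullet> b)"
    if ab: "norm a = 1" "norm b = 1" for a b :: 'a
  proof -
    define u v where "u = a \<bullet> b" and "v = sqrt (1 - u\<^sup>2)"
    have "\<bar>u\<bar> \<le> 1"
      using Cauchy_Schwarz_ineq2[of a b] ab by (simp add: u_def)
    then have v2: "v\<^sup>2 = 1 - u\<^sup>2"
      by (simp add: v_def abs_square_le_1)
    have "norm (u *\<^sub>R e + v *\<^sub>R c) ^ 2 = u\<^sup>2 + v\<^sup>2"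
      unfolding power2_norm_eq_inner using ec
      by (simp add: inner_add_left inner_add_right inner_Basis power2_eq_square)
    then have n: "norm (u *\<^sub>R e + v *\<^sub>R c) = 1"
      using v2 norm_ge_zero[of "u *\<^sub>R e + v *\<^sub>R c"] by (auto simp: power2_eq_1_iff simp del: norm_ge_zero)
    have "(\<integral>z. g (a \<bullet> z) * poly p (b \<bullet> z) \<partial>sphere_measure)
        = (\<integral>z. g (e \<bullet> z) * poly p ((u *\<^sub>R e + v *\<^sub>R c) \<bullet> z) \<partial>sphere_measure)"
      using ab n ec
      by (intro integral_sphere_measure_pair_cong[of a e b _ "\<lambda>s t. g s * poly p t"])
         (auto simp: split_beta inner_add_right inner_Basis u_def intro!: continuous_intros gc)
    also have "\<dots> = (\<integral>z. (\<Sum>j\<le>degree p. \<Sum>r\<le>j. coeff p j * of_nat (j choose r) * u ^ (j - r) * v ^ r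
        * (g (e \<bullet> z) * (e \<bullet> z) ^ (j - r) * (c \<bullet> z) ^ r)) \<partial>sphere_measure)"
    proof (rule Bochner_Integration.integral_cong[OF refl])
      fix z
      have split: "(u *\<^sub>R e + v *\<^sub>R c) \<bullet> z = v * (c \<bullet> z) + u * (e \<bullet> z)"
        by (simp add: inner_add_left)
      show "g (e \<bullet> z) * poly p ((u *\<^sub>R e + v *\<^sub>R c) \<bullet> z)
        = (\<Sum>j\<le>degree p. \<Sum>r\<le>j. coeff p j * of_nat (j choose r) * u ^ (j - r) * v ^ r
            * (g (e \<bullet> z) * (e \<bullet> z) ^ (j - r) * (c \<bullet> z) ^ r))"
        unfolding split poly_altdef binomial_ring
        by (simp add: sum_distrib_left power_mult_distrib mult_ac)
    qed
    also have "\<dots> = (\<Sum>j\<le>degree p. \<Sum>r\<le>j. coeff p j * of_nat (j choose r) * u ^ (j - r) * v ^ r * A j r)"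
    proof -
      have "integrable sphere_measure (\<lambda>z. g (e \<bullet> z) * (e \<bullet> z) ^ (j - r) * (c \<bullet> z) ^ r)" for j r
        by (intro integrable_sphere_measure continuous_intros gc)
      then show ?thesis
        by (simp add: A_def Bochner_Integration.integral_sum)
    qed
    also have "\<dots> = (\<Sum>j\<le>degree p. \<Sum>r\<le>j. coeff p j * poly (S j r) u)"
    proof (intro sum.cong refl)
      fix j r
      show "coeff p j * of_nat (j choose r) * u ^ (j - r) * v ^ r * A j r = coeff p j * poly (S j r) u"
      proof (cases "even r")
        case True
        then have "v ^ r = (1 - u\<^sup>2) ^ (r div 2)"
          by (metis v2 dvd_mult_div_cancel power_mult)
        with True show ?thesis by (simp add: S_def poly_power power2_eq_square)
      qed (simp add: A_odd S_def)
    qed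
    also have "\<dots> = poly R u"
      by (simp add: R_def poly_sum sum_distrib_left)
    finally show ?thesis by (simp add: u_def)
  qed
  ultimately show ?thesis using that by blast
qed

section \<open>Positive definiteness of the Gegenbauer polynomials\<close>

text \<open>
  The polynomials \<open>G 0\<close>, ..., \<open>G d\<close> span all polynomials of degree at most \<open>d\<close>, by elimination of
  leading coefficients. In the application \<open>L p\<close> is the integral of \<open>poly p (e \<bullet> z)\<close> over the sphere.
\<close>

lemma orthogonal_to_lower_degree:
  fixes G :: "nat \<Rightarrow> real poly" and L :: "real poly \<Rightarrow> real"
  assumes deg: "\<And>k. degree (G k) = k" and G0: "\<And>k. G k \<noteq> 0"
    and add: "\<And>p q. L (p + q) = L p + L q" and smult: "\<And>c p. L (smult c p) = c * L p"
    and orth: "\<And>j k. j \<noteq> k \<Longrightarrow> L (G j * G k) = 0"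
  shows "degree p < k \<Longrightarrow> L (G k * p) = 0"
proof (induction "degree p" arbitrary: p rule: less_induct)
  case less
  define d where "d = degree p"
  define q where "q = p - smult (coeff p d / coeff (G d) d) (G d)"
  have lc: "coeff (G d) d \<noteq> 0"
    using G0[of d] deg[of d] by (metis leading_coeff_0_iff)
  have "coeff q d = 0"
    using lc by (simp add: q_def)
  moreover have "degree q \<le> d"
    unfolding q_def by (intro degree_diff_le) (auto simp: d_def deg intro: order_trans[OF degree_smult_le])
  ultimately have q: "q = 0 \<or> degree q < d"
    by (metis leading_coeff_0_iff order_le_less)
  have L0: "L 0 = 0" using smult[of 0 0] by simp
  have Lq: "L (G k * q) = 0"
    using q less L0 by (auto simp: d_def)
  have "G k * p = G k * q + smult (coeff p d / coeff (G d) d) (G k * G d)"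
    by (simp add: q_def algebra_simps)
  then have "L (G k * p) = L (G k * q) + coeff p d / coeff (G d) d * L (G k * G d)"
    by (simp only: add smult)
  also have "L (G k * G d) = 0"
    using less.prems by (intro orth) (simp add: d_def)
  finally show ?case using Lq by simp
qed

text \<open>
  The difference of \<open>Q\<close> and the multiple of \<open>G k\<close> with the same leading coefficient has degree less
  than \<open>k\<close>, and is orthogonal to all such polynomials, in particular to itself.
\<close>

lemma orthogonal_poly_unique:
  fixes G :: "nat \<Rightarrow> real poly" and L :: "real poly \<Rightarrow> real"
  assumes deg: "\<And>k. degree (G k) = k" and one: "\<And>k. poly (G k) 1 = 1"
    and add: "\<And>p q. L (p + q) = L p + L q" and smult: "\<And>c p. L (smult c p) = c * L p"
    and orth: "\<And>j k. j \<noteq> k \<Longrightarrow> L (G j * G k) = 0"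
    and definite: "\<And>p. L (p * p) = 0 \<Longrightarrow> p = 0"
    and Q: "degree Q \<le> k" "\<And>p. degree p < k \<Longrightarrow> L (Q * p) = 0"
  shows "Q = smult (poly Q 1) (G k)"
proof -
  have G0: "G k \<noteq> 0" for k using one[of k] by auto
  define r where "r = coeff Q k / coeff (G k) k"
  define p where "p = Q - smult r (G k)"
  have lc: "coeff (G k) k \<noteq> 0"
    using G0[of k] deg[of k] by (metis leading_coeff_0_iff)
  have "coeff p k = 0"
    using lc by (simp add: p_def r_def)
  moreover have "degree p \<le> k"
    unfolding p_def using Q(1) by (intro degree_diff_le) (auto simp: deg intro: order_trans[OF degree_smult_le])
  ultimately have p: "p = 0 \<or> degree p < k"
    by (metis leading_coeff_0_iff order_le_less)
  have "p = 0"
  proof (rule ccontr)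
    assume "p \<noteq> 0"
    with p have "degree p < k" by simp
    then have "L (Q * p) = 0" "L (G k * p) = 0"
      using Q(2) orthogonal_to_lower_degree[of G L, OF deg G0 add smult orth] by auto
    moreover have "p * p = Q * p + smult (- r) (G k * p)"
    proof -
      have "p * p = (Q - smult r (G k)) * p" by (simp only: p_def)
      then show ?thesis by (simp only: left_diff_distrib) simp
    qed
    then have "L (p * p) = L (Q * p) + (- r) * L (G k * p)"
      by (simp only: add smult)
    ultimately have "L (p * p) = 0" by simp
    with \<open>p \<noteq> 0\<close> definite show False by blast
  qed
  then have Q_eq: "Q = smult r (G k)" by (simp add: p_def)
  then have r: "poly Q 1 = r" using one by simp
  show ?thesis unfolding r by (rule Q_eq)
qed

lemma integral_zonal_Gegenbauer_orthogonal:
  fixes a :: "'a::euclidean_space"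
  assumes dim: "DIM('a) \<ge> 2" and G: "is_gegenbauer_family DIM('a) G"
    and "j \<noteq> k" "norm a = 1"
  shows "(\<integral>z. poly (G j * G k) (a \<bullet> z) \<partial>sphere_measure) = 0"
proof -
  obtain C where C: "C > 0"
    "\<And>(a::'a) p. norm a = 1 \<Longrightarrow>
       ((\<lambda>x. poly p x * (1 - x\<^sup>2) powr ((real DIM('a) - 3) / 2)) has_integral
          C * (\<integral>z. poly p (a \<bullet> z) \<partial>sphere_measure)) {-1..1}"
    using integral_zonal_poly[OF dim] by blast
  have "((\<lambda>x. poly (G j * G k) x * (1 - x\<^sup>2) powr ((real DIM('a) - 3) / 2)) has_integral 0) {-1..1}"
    using G \<open>j \<noteq> k\<close> by (simp add: is_gegenbauer_family_def)
  from has_integral_unique[OF C(2)[OF \<open>norm a = 1\<close>] this] C(1) show ?thesis by simp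
qed

lemma integral_zonal_square_definite:
  fixes a :: "'a::euclidean_space"
  assumes dim: "DIM('a) \<ge> 2" and "norm a = 1"
    and 0: "(\<integral>z. poly (p * p) (a \<bullet> z) \<partial>sphere_measure) = 0"
  shows "p = 0"
proof -
  obtain C where C: "C > 0"
    "\<And>(a::'a) p. norm a = 1 \<Longrightarrow>
       ((\<lambda>x. poly p x * (1 - x\<^sup>2) powr ((real DIM('a) - 3) / 2)) has_integral
          C * (\<integral>z. poly p (a \<bullet> z) \<partial>sphere_measure)) {-1..1}"
    using integral_zonal_poly[OF dim] by blast
  from C(2)[OF \<open>norm a = 1\<close>, of "p * p"] show ?thesis
    unfolding 0 by (intro ultraspherical_weight_definite) simp
qed

text \<open>
  The left-hand side is a polynomial \<open>Q\<close> in \<open>a \<bullet> b\<close> of degree at most \<open>k\<close>. It inherits from \<open>G k\<close> the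
  orthogonality to lower degrees, and so is a multiple of \<open>G k\<close>. The factor, found by putting \<open>a = b\<close>, is the squared norm of \<open>G k\<close> and hence positive.
\<close>

lemma Gegenbauer_reproducing:
  assumes dim: "DIM('a::euclidean_space) \<ge> 2" and G: "is_gegenbauer_family DIM('a) G"
  obtains \<kappa> where "\<kappa> > 0"
    "\<And>a b::'a. norm a = 1 \<Longrightarrow> norm b = 1 \<Longrightarrow>
      (\<integral>z. poly (G k) (a \<bullet> z) * poly (G k) (b \<bullet> z) \<partial>sphere_measure) = \<kappa> * poly (G k) (a \<bullet> b)"
proof -
  have deg: "degree (G k) = k" and one: "poly (G k) 1 = 1" for k
    using G by (auto simp: is_gegenbauer_family_def)
  have G0: "G k \<noteq> 0" for k using one[of k] by auto
  obtain e :: 'a where "e \<in> Basis" using nonempty_Basis by blast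
  then have e: "norm e = 1" by simp
  define L where "L p = (\<integral>z. poly p (e \<bullet> z) \<partial>sphere_measure)" for p
  have int: "integrable sphere_measure (\<lambda>z. poly p (a \<bullet> z))" for p and a :: 'a
    by (intro integrable_sphere_measure continuous_intros)
  have add: "L (p + q) = L p + L q" and smult: "L (smult c p) = c * L p" for p q c
    by (simp_all add: L_def int)
  have orth: "L (G j * G k) = 0" if "j \<noteq> k" for j k
    unfolding L_def using dim G that e by (rule integral_zonal_Gegenbauer_orthogonal)
  have definite: "p = 0" if "L (p * p) = 0" for p
    using dim e that unfolding L_def by (rule integral_zonal_square_definite)
  have low: "L (G k * p) = 0" if "degree p < k" for p
    by (rule orthogonal_to_lower_degree[where G = G and L = L])
       (fact deg G0 add smult orth that)+
  have cont: "continuous_on UNIV (poly (G k))"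
    by (rule continuous_on_poly[OF continuous_on_id])
  obtain Q where Q: "degree Q \<le> degree (G k)"
    "\<And>a b::'a. norm a = 1 \<Longrightarrow> norm b = 1 \<Longrightarrow>
      (\<integral>z. poly (G k) (a \<bullet> z) * poly (G k) (b \<bullet> z) \<partial>sphere_measure) = poly Q (a \<bullet> b)"
    by (rule zonal_convolution_poly[OF dim cont, of "G k"]) (rule that)
  \<comment> \<open>Exchanging the integrals makes the inner one a convolution of \<open>G k\<close> with \<open>p\<close>, hence again a
    polynomial \<open>R\<close> of degree less than \<open>k\<close>, to which the remaining factor \<open>G k\<close> is orthogonal.\<close>
  have "L (Q * p) = 0" if p: "degree p < k" for p
  proof -
    obtain R where R: "degree R \<le> degree p"
      "\<And>a b::'a. norm a = 1 \<Longrightarrow> norm b = 1 \<Longrightarrow>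
        (\<integral>z. poly (G k) (a \<bullet> z) * poly p (b \<bullet> z) \<partial>sphere_measure) = poly R (a \<bullet> b)"
      by (rule zonal_convolution_poly[OF dim cont, of p]) (rule that)
    have "L (Q * p) = (\<integral>y. (\<integral>z. poly (G k) (e \<bullet> z) * poly (G k) (y \<bullet> z) * poly p (e \<bullet> y) \<partial>sphere_measure) \<partial>sphere_measure)"
      unfolding L_def
      by (rule Bochner_Integration.integral_cong[OF refl]) (simp add: Q(2)[OF e, symmetric])
    also have "\<dots> = (\<integral>z. (\<integral>y. poly (G k) (e \<bullet> z) * poly (G k) (y \<bullet> z) * poly p (e \<bullet> y) \<partial>sphere_measure) \<partial>sphere_measure)"
      by (rule sphere_measure_Fubini) (auto simp: split_beta intro!: continuous_intros)
    also have "\<dots> = (\<integral>z. poly (G k) (e \<bullet> z) * poly R (e \<bullet> z) \<partial>sphere_measure)"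
    proof (rule Bochner_Integration.integral_cong[OF refl])
      fix z :: 'a assume "z \<in> space sphere_measure"
      then have "norm z = 1" by simp
      have "(\<integral>y. poly (G k) (e \<bullet> z) * poly (G k) (y \<bullet> z) * poly p (e \<bullet> y) \<partial>sphere_measure)
          = poly (G k) (e \<bullet> z) * (\<integral>y. poly (G k) (z \<bullet> y) * poly p (e \<bullet> y) \<partial>sphere_measure)"
        by (simp add: mult.assoc inner_commute)
      also have "\<dots> = poly (G k) (e \<bullet> z) * poly R (e \<bullet> z)"
        using R(2)[OF \<open>norm z = 1\<close> e] by (simp add: inner_commute)
      finally show "(\<integral>y. poly (G k) (e \<bullet> z) * poly (G k) (y \<bullet> z) * poly p (e \<bullet> y) \<partial>sphere_measure)
          = poly (G k) (e \<bullet> z) * poly R (e \<bullet> z)" .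
    qed
    also have "\<dots> = L (G k * R)"
      by (simp add: L_def)
    also have "\<dots> = 0"
      using R(1) p by (intro low) simp
    finally show ?thesis .
  qed
  then have Q_orth: "\<And>p. degree p < k \<Longrightarrow> L (Q * p) = 0" .
  have Q_eq: "Q = smult (poly Q 1) (G k)"
    by (rule orthogonal_poly_unique[where G = G and L = L])
       (fact deg one add smult orth definite Q(1)[unfolded deg] Q_orth)+
  have "poly Q 1 = L (G k * G k)"
    using Q(2)[OF e e] e by (simp add: L_def norm_eq_1)
  moreover have "L (G k * G k) \<ge> 0"
    unfolding L_def by (intro Bochner_Integration.integral_nonneg) simp
  moreover have "L (G k * G k) \<noteq> 0"
    using definite[of "G k"] G0[of k] by blast
  ultimately have "poly Q 1 > 0" by simp
  moreover have "(\<integral>z. poly (G k) (a \<bullet> z) * poly (G k) (b \<bullet> z) \<partial>sphere_measure) = poly Q 1 * poly (G k) (a \<bullet> b)"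
    if "norm a = 1" "norm b = 1" for a b :: 'a
    using Q(2)[OF that] arg_cong[OF Q_eq, of "\<lambda>q. poly q (a \<bullet> b)"] by (simp only: poly_smult)
  ultimately show ?thesis
    by (rule that)
qed

text \<open>
  By the reproducing formula the quadratic form is a positive multiple of the integral of
  \<open>(\<Sum>i\<in>I. w i * poly (G k) (v i \<bullet> z))\<^sup>2\<close>.
\<close>

lemma Gegenbauer_positive_definite:
  fixes v :: "'i \<Rightarrow> 'a::euclidean_space" and w :: "'i \<Rightarrow> real"
  assumes dim: "DIM('a) \<ge> 2" and G: "is_gegenbauer_family DIM('a) G"
    and v: "\<And>i. i \<in> I \<Longrightarrow> norm (v i) = 1"
  shows "(\<Sum>i\<in>I. \<Sum>j\<in>I. w i * w j * poly (G k) (v i \<bullet> v j)) \<ge> 0"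
proof -
  obtain \<kappa> where \<kappa>: "\<kappa> > 0"
    "\<And>a b::'a. norm a = 1 \<Longrightarrow> norm b = 1 \<Longrightarrow>
      (\<integral>z. poly (G k) (a \<bullet> z) * poly (G k) (b \<bullet> z) \<partial>sphere_measure) = \<kappa> * poly (G k) (a \<bullet> b)"
    using Gegenbauer_reproducing[OF dim G, of k] by blast
  have int: "integrable sphere_measure (\<lambda>z. w i * w j * (poly (G k) (v i \<bullet> z) * poly (G k) (v j \<bullet> z)))" for i j
    by (intro integrable_sphere_measure continuous_intros)
  have "0 \<le> (\<integral>z. (\<Sum>i\<in>I. w i * poly (G k) (v i \<bullet> z))\<^sup>2 \<partial>sphere_measure)"
    by (intro Bochner_Integration.integral_nonneg) simp
  also have "\<dots> = (\<integral>z. (\<Sum>i\<in>I. \<Sum>j\<in>I. w i * w j * (poly (G k) (v i \<bullet> z) * poly (G k) (v j \<bullet> z))) \<partial>sphere_measure)"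
    by (simp add: power2_eq_square sum_product mult_ac)
  also have "\<dots> = (\<Sum>i\<in>I. \<Sum>j\<in>I. w i * w j * (\<integral>z. poly (G k) (v i \<bullet> z) * poly (G k) (v j \<bullet> z) \<partial>sphere_measure))"
    using int by (simp add: Bochner_Integration.integral_sum)
  also have "\<dots> = (\<Sum>i\<in>I. \<Sum>j\<in>I. \<kappa> * (w i * w j * poly (G k) (v i \<bullet> v j)))"
    using v by (intro sum.cong refl) (simp add: \<kappa>(2))
  also have "\<dots> = \<kappa> * (\<Sum>i\<in>I. \<Sum>j\<in>I. w i * w j * poly (G k) (v i \<bullet> v j))"
    by (simp add: sum_distrib_left)
  finally show ?thesis
    using \<kappa>(1) by (simp add: zero_le_mult_iff)
qed

text \<open>
  Positive definiteness for two unit vectors with inner product \<open>t\<close> and weights \<open>1\<close> and \<open>\<plusminus>1\<close>. The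
  vectors are indexed by booleans, because they coincide when \<open>t = 1\<close>.
\<close>

lemma Gegenbauer_abs_le_one:
  assumes dim: "DIM('a::euclidean_space) \<ge> 2" and G: "is_gegenbauer_family DIM('a) G"
    and t: "t \<in> {-1..1}"
  shows "\<bar>poly (G k) t\<bar> \<le> 1"
proof -
  obtain e c :: 'a where ec: "e \<in> Basis" "c \<in> Basis" "e \<noteq> c"
    using dim card_le_Suc0_iff_eq[of "Basis :: 'a set"] by fastforce
  have one: "poly (G k) 1 = 1"
    using G by (simp add: is_gegenbauer_family_def)
  define y where "y = t *\<^sub>R e + sqrt (1 - t\<^sup>2) *\<^sub>R c"
  have "1 - t\<^sup>2 \<ge> 0"
    using t by (simp add: abs_square_le_1 abs_le_iff)
  then have yy: "y \<bullet> y = 1"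
    using ec by (simp add: y_def inner_add_left inner_add_right inner_Basis flip: power2_eq_square)
  have ey: "e \<bullet> y = t"
    using ec by (simp add: y_def inner_add_right inner_Basis)
  have "0 \<le> 2 + 2 * s * poly (G k) t" if s: "s * s = 1" for s :: real
  proof -
    have "0 \<le> (\<Sum>i\<in>UNIV. \<Sum>j\<in>UNIV. (if i then 1 else s) * (if j then 1 else s)
        * poly (G k) ((if i then e else y) \<bullet> (if j then e else y)))"
      using yy ec by (intro Gegenbauer_positive_definite[OF dim G]) (auto simp: norm_eq_1)
    then show ?thesis
      using ec s by (simp add: UNIV_bool yy ey one inner_commute[of y e])
  qed
  from this[of 1] this[of "-1"] show ?thesis by simp
qed

lemma inner_unit_vectors:
  fixes x y :: "'a::real_inner"
  assumes "norm x = 1" "norm y = 1"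
  shows "x \<bullet> y \<in> {-1..1}"
  using Cauchy_Schwarz_ineq2[of x y] assms by (auto simp: abs_le_iff)

lemma sum_code_ge:
  fixes C :: "'a::euclidean_space set" and f :: "real \<Rightarrow> real"
  assumes dim: "DIM('a) \<ge> 2" and G: "is_gegenbauer_family DIM('a) G"
    and f: "\<And>t. t \<in> {-1..1} \<Longrightarrow> (\<lambda>k. c k * poly (G k) t) sums f t"
    and c: "\<And>k. c k \<ge> 0"
    and C: "C \<subseteq> sphere 0 1"
  shows "c 0 * (real (card C))\<^sup>2 \<le> (\<Sum>x\<in>C. \<Sum>y\<in>C. f (x \<bullet> y))"
proof -
  define S where "S k = (\<Sum>x\<in>C. \<Sum>y\<in>C. c k * poly (G k) (x \<bullet> y))" for k
  have "x \<bullet> y \<in> {-1..1}" if "x \<in> C" "y \<in> C" for x y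
    using C that by (intro inner_unit_vectors) auto
  then have S: "S sums (\<Sum>x\<in>C. \<Sum>y\<in>C. f (x \<bullet> y))"
    unfolding S_def by (intro sums_sum f)
  have pos: "S k \<ge> 0" for k
  proof -
    have "(\<Sum>x\<in>C. \<Sum>y\<in>C. 1 * 1 * poly (G k) (x \<bullet> y)) \<ge> 0"
      using C by (intro Gegenbauer_positive_definite[OF dim G]) auto
    then show ?thesis
      using c[of k] by (simp add: S_def flip: sum_distrib_left)
  qed
  have "degree (G 0) = 0" "poly (G 0) 1 = 1"
    using G by (auto simp: is_gegenbauer_family_def)
  then have "poly (G 0) t = 1" for t
    by (auto elim: degree_eq_zeroE)
  then have "S 0 = c 0 * (real (card C))\<^sup>2"
    by (simp add: S_def power2_eq_square)
  moreover have "S 0 \<le> (\<Sum>x\<in>C. \<Sum>y\<in>C. f (x \<bullet> y))"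
    using sum_le_suminf[OF sums_summable[OF S], of "{0}"] pos sums_unique[OF S] by simp
  ultimately show ?thesis by simp
qed

section \<open>The bound for spherical codes\<close>

lemma is_code_subset: "is_code \<theta> C \<Longrightarrow> D \<subseteq> C \<Longrightarrow> is_code \<theta> D"
  unfolding is_code_def by (meson finite_subset subset_trans subsetD)

lemma is_code_orthogonal_image:
  fixes T :: "real ^ 'n \<Rightarrow> real ^ 'n"
  assumes T: "orthogonal_transformation T" and C: "is_code \<theta> C"
  shows "is_code \<theta> (T ` C)"
proof -
  have "T x \<bullet> T y = x \<bullet> y" "norm (T x) = norm x" for x y
    using T by (simp_all add: orthogonal_transformation_def orthogonal_transformation_norm[OF T])
  with C show ?thesis
    unfolding is_code_def angular_dist_def by auto
qed

lemma norm_north_pole [simp]: "norm (north_pole :: real ^ 'n::{finite,linorder}) = 1"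
  by (simp add: north_pole_def)

text \<open>
  The upper bound on \<open>f\<close> ensures that the supremum in \<open>h_opt\<close> is taken over a set that is bounded
  above.
\<close>

lemma H_sum_le_h_max:
  fixes Y :: "(real ^ 'n::{finite,linorder}) set" and f :: "real \<Rightarrow> real"
  assumes \<theta>: "0 < \<theta>" "\<theta> \<le> pi" and f: "\<And>t. t \<in> {-1..1} \<Longrightarrow> f t \<le> B"
    and Y: "is_code \<theta> Y" "Y \<subseteq> Cap \<phi>"
  shows "H_sum f Y \<le> h_max TYPE('n) \<theta> \<phi> f"
proof -
  define m where "m = card Y"
  let ?H = "{H_sum f Y | Y :: (real, 'n) vec set. is_code \<theta> Y \<and> Y \<subseteq> Cap \<phi> \<and> card Y = m}"
  have "H_sum f Z \<le> f 1 + real m * B"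
    if Z: "is_code \<theta> Z" "card Z = m" for Z :: "(real, 'n) vec set"
  proof -
    have "f ((- north_pole) \<bullet> z) \<le> B" if "z \<in> Z" for z
      using that Z(1) by (intro f inner_unit_vectors) (auto simp: is_code_def)
    then show ?thesis
      using sum_bounded_above[of Z "\<lambda>z. f ((- north_pole) \<bullet> z)" B] Z(2) by (simp add: H_sum_def)
  qed
  then have "bdd_above ?H" by (intro bdd_aboveI[of _ "f 1 + real m * B"]) blast
  then have "H_sum f Y \<le> h_opt TYPE('n) \<theta> \<phi> f m"
    unfolding h_opt_def by (rule cSup_upper[rotated]) (use Y m_def in blast)
  also have "m \<le> max_cap_code TYPE('n) \<theta> \<phi>"
    unfolding max_cap_code_def m_def by (rule Max_ge[OF finite_code_sizes(2)[OF \<theta>]]) (use Y in blast)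
  then have "h_opt TYPE('n) \<theta> \<phi> f m \<le> h_max TYPE('n) \<theta> \<phi> f"
    unfolding h_max_def by (intro Max_ge) auto
  finally show ?thesis .
qed

text \<open>
  The points that can contribute positively, apart from \<open>x\<close> itself, form the set \<open>Y\<close>. Since
  \<open>x \<bullet> y = - north_pole \<bullet> T y\<close> for an orthogonal map \<open>T\<close> with \<open>T x = - north_pole\<close>, the image of
  \<open>Y\<close> is a code in the cap, and \<open>H_sum\<close> evaluates to the bound on the row.
\<close>

lemma sum_code_row_le:
  fixes C :: "(real ^ 'n::{finite,linorder}) set" and f :: "real \<Rightarrow> real"
  assumes \<theta>: "0 < \<theta>" "\<theta> \<le> pi" and \<phi>: "0 \<le> \<phi>" "\<phi> \<le> pi / 2"
    and f: "\<And>t. t \<in> {-1..1} \<Longrightarrow> f t \<le> B"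
    and nonpos: "\<And>t. t \<in> {- cos \<phi>..cos \<theta>} \<Longrightarrow> f t \<le> 0"
    and C: "is_code \<theta> C" and x: "x \<in> C"
  shows "(\<Sum>y\<in>C. f (x \<bullet> y)) \<le> h_max TYPE('n) \<theta> \<phi> f"
proof -
  have fin: "finite C" and sph: "\<And>y. y \<in> C \<Longrightarrow> norm y = 1"
    using C by (auto simp: is_code_def)
  have xx: "x \<bullet> x = 1" using sph[OF x] by (simp add: norm_eq_1)
  have "cos \<phi> \<ge> 0" using \<phi> by (intro cos_ge_zero) auto
  define Y where "Y = {y \<in> C. x \<bullet> y < - cos \<phi>}"
  have Y: "Y \<subseteq> C - {x}" using xx \<open>cos \<phi> \<ge> 0\<close> by (auto simp: Y_def)
  obtain T :: "(real, 'n) vec \<Rightarrow> (real, 'n) vec" where T: "orthogonal_transformation T" "T x = - north_pole"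
    by (rule orthogonal_transformation_pair_exists[of x "- north_pole" 0 0])
       (use sph[OF x] in \<open>simp_all add: that\<close>)
  have inner: "(- north_pole) \<bullet> T y = x \<bullet> y" for y
    using T by (metis orthogonal_transformation_def)
  have "f (x \<bullet> y) \<le> 0" if "y \<in> C - {x} - Y" for y
  proof (rule nonpos)
    have "angular_dist x y \<ge> \<theta>" using C x that by (auto simp: is_code_def)
    then have "x \<bullet> y \<le> cos \<theta>"
      using angular_dist_ge_iff[of x y \<theta>] \<theta> sph x that by auto
    then show "x \<bullet> y \<in> {- cos \<phi>..cos \<theta>}" using that by (auto simp: Y_def)
  qed
  then have "(\<Sum>y\<in>C - {x} - Y. f (x \<bullet> y)) \<le> 0" by (rule sum_nonpos)
  moreover have "(\<Sum>y\<in>C. f (x \<bullet> y)) = f 1 + ((\<Sum>y\<in>C - {x} - Y. f (x \<bullet> y)) + (\<Sum>y\<in>Y. f (x \<bullet> y)))"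
    using fin x Y xx by (simp add: sum.remove[of C x] sum.subset_diff[of Y "C - {x}"])
  ultimately have "(\<Sum>y\<in>C. f (x \<bullet> y)) \<le> f 1 + (\<Sum>y\<in>Y. f (x \<bullet> y))" by simp
  also have "\<dots> = H_sum f (T ` Y)"
    unfolding H_sum_def
    by (subst sum.reindex)
       (simp_all only: inner o_def inj_on_subset[OF orthogonal_transformation_inj[OF T(1)]] subset_UNIV)
  also have "\<dots> \<le> h_max TYPE('n) \<theta> \<phi> f"
  proof (rule H_sum_le_h_max[OF \<theta> f])
    show "is_code \<theta> (T ` Y)"
      using T(1) is_code_subset[OF C] by (intro is_code_orthogonal_image) (auto simp: Y_def)
    then have "T ` Y \<subseteq> sphere 0 1" by (simp add: is_code_def)
    moreover have "T y \<bullet> north_pole \<ge> cos \<phi>" if "y \<in> Y" for y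
      using that inner[of y] by (simp add: Y_def inner_commute)
    ultimately show "T ` Y \<subseteq> Cap \<phi>"
      by (auto simp: Cap_def)
  qed
  finally show ?thesis .
qed

theorem theorem4:
  fixes \<theta> \<phi> :: real and f :: "real \<Rightarrow> real" and G :: "nat \<Rightarrow> real poly" and c :: "nat \<Rightarrow> real"
  assumes "CARD('n::{finite,linorder}) \<ge> 2"
    and "0 < \<theta>" "\<theta> \<le> pi" and "0 \<le> \<phi>" "\<phi> \<le> pi / 2"
    and "is_gegenbauer_family CARD('n) G"
    and "\<And>t. t \<in> {-1..1} \<Longrightarrow> (\<lambda>k. c k * poly (G k) t) sums f t"
    and "\<And>k. c k \<ge> 0"
    and "\<And>t. t \<in> {- cos \<phi>..cos \<theta>} \<Longrightarrow> f t \<le> 0"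
    and "c 0 > 0"
  shows "real (max_code TYPE('n) \<theta>) \<le> h_max TYPE('n) \<theta> \<phi> f / c 0"
proof -
  have dim: "DIM((real, 'n) vec) \<ge> 2" and G: "is_gegenbauer_family DIM((real, 'n) vec) G"
    using assms(1,6) by simp_all
  have one: "poly (G k) 1 = 1" for k
    using assms(6) by (simp add: is_gegenbauer_family_def)
  \<comment> \<open>All Gegenbauer polynomials attain their maximum over the interval at \<open>1\<close>.\<close>
  have bound: "f t \<le> f 1" if t: "t \<in> {-1..1}" for t
  proof (rule sums_le[OF _ assms(7)[OF t] assms(7)[of 1]])
    show "c k * poly (G k) t \<le> c k * poly (G k) 1" for k
      using Gegenbauer_abs_le_one[OF dim G t, of k] assms(8)[of k]
      by (intro mult_left_mono) (auto simp: one)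
  qed simp
  have "max_code TYPE('n) \<theta> \<in> {card C | C :: (real, 'n) vec set. is_code \<theta> C}"
    unfolding max_code_def
  proof (rule Max_in)
    show "finite {card C | C :: (real, 'n) vec set. is_code \<theta> C}"
      by (rule finite_code_sizes(1)[OF assms(2,3)])
    have "is_code \<theta> ({} :: (real, 'n) vec set)" by (simp add: is_code_def)
    then show "{card C | C :: (real, 'n) vec set. is_code \<theta> C} \<noteq> {}" by blast
  qed
  then obtain C :: "(real, 'n) vec set" where C: "is_code \<theta> C" "max_code TYPE('n) \<theta> = card C"
    by auto
  show ?thesis
  proof (cases "card C = 0")
    case True
    have "0 \<le> f 1"
      using bound[of 0] sums_le[OF _ sums_zero assms(7)[of 1]] assms(8) by (simp add: one)
    also have "\<dots> = H_sum f ({} :: (real, 'n) vec set)"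
      by (simp add: H_sum_def)
    also have "\<dots> \<le> h_max TYPE('n) \<theta> \<phi> f"
      using bound by (intro H_sum_le_h_max[OF assms(2,3)]) (auto simp: is_code_def)
    finally show ?thesis using True C(2) assms(10) by simp
  next
    case False
    have "c 0 * (real (card C))\<^sup>2 \<le> (\<Sum>x\<in>C. \<Sum>y\<in>C. f (x \<bullet> y))"
      using C(1) by (intro sum_code_ge[OF dim G assms(7,8)]) (auto simp: is_code_def)
    also have "\<dots> \<le> (\<Sum>x\<in>C. h_max TYPE('n) \<theta> \<phi> f)"
      by (intro sum_mono sum_code_row_le[OF assms(2-5) bound assms(9) C(1)])
    finally have "real (card C) * (real (card C) * c 0) \<le> real (card C) * h_max TYPE('n) \<theta> \<phi> f"
      by (simp add: power2_eq_square mult_ac)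
    then have "real (card C) * c 0 \<le> h_max TYPE('n) \<theta> \<phi> f"
      using False by simp
    then show ?thesis
      using C(2) assms(10) by (simp add: pos_le_divide_eq)
  qed
qed

end
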